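(* Assume conditions (M) and (CC). Suppose that $\emptyset\in\Psi$, $\mathsf P\in\mathcal P_\Psi\setminus\mathcal H_0$, let the detection subsystems be selected so that $$\max_{e\in\mathcal A(\mathsf P)}\mathcal I(\mathsf P,\mathcal H_0;s_e)=\mathcal I(\mathsf P,\mathcal H_0),$$ and let the isolation subsystems be selected so that $$\min_{e\in\mathcal A(\mathsf P)}\mathcal I(\mathsf P,\mathcal H_{\Psi,e};s'_e)=\min_{e\in\mathcal A(\mathsf P)}\mathcal I(\mathsf P,\mathcal H_{\Psi,e}),\qquad \min_{e\notin\mathcal A(\mathsf P)}\mathcal I(\mathsf P,\mathcal G_{\Psi,e};s'_e)=\min_{e\notin\mathcal A(\mathsf P)}\mathcal I(\mathsf P,\mathcal G_{\Psi,e}).$$ Then, as $\gamma,\delta\to0$, $$\mathsf E_{\mathsf P}[T^*_{fwer}]\sim\max_{e\in\mathcal A(\mathsf P)}\Big\{\frac{|\log\gamma|}{\mathcal I(\mathsf P,\mathcal H_0)\wedge\mathcal I(\mathsf P,\mathcal H_{\Psi,e})}\Big\}\bigvee\max_{e\notin\mathcal A(\mathsf P)}\Big\{\frac{|\log\delta|}{\mathcal I(\mathsf P,\mathcal G_{\Psi,e})}\Big\}\sim\inf\{\mathsf E_{\mathsf P}[T]:(T,D)\in\mathcal E_\Psi(\gamma,\delta)\},$$ and, as $\alpha,\beta,\gamma,\delta\to0$, $$\mathsf E_{\mathsf P}[T^*]\sim\frac{|\log\alpha|}{\mathcal I(\mathsf P,\mathcal H_0)}\bigvee\max_{e\in\mathcal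 A(\mathsf P)}\Big\{\frac{|\log\gamma|}{\mathcal I(\mathsf P,\mathcal H_{\Psi,e})}\Big\}\bigvee\max_{e\notin\mathcal A(\mathsf P)}\Big\{\frac{|\log\delta|}{\mathcal I(\mathsf P,\mathcal G_{\Psi,e})}\Big\}\sim\inf\{\mathsf E_{\mathsf P}[T]:(T,D)\in\mathcal C_\Psi(\alpha,\beta,\gamma,\delta)\}.$$
   Context: Setting. There are $K$ data sources, $[K]=\{1,\dots,K\}$; $X_n^k$ is the random element observed from source $k$ at time $n\in\mathbb N=\{1,2,\dots\}$. For $s\subseteq[K]$: $X_n^s=\{X_n^k:k\in s\}$, $X^s=\{X_n^s:n\in\mathbb N\}$, $\mathcal F_n^s=\sigma(X_1^s,\dots,X_n^s)$; the superscript is omitted when $s=[K]$. $\mathcal P$ is a finite family of distributions of $X$; $\mathsf P^s$ is the law of $X^s$ under $\mathsf P$, and $\mathcal Q^s=\{\mathsf P^s:\mathsf P\in\mathcal Q\}$. $\mathcal K$ is a finite family of subsets of $[K]$ (units). For each $e\in\mathcal K$, $\mathcal H^e$ and $\mathcal G^e$ are nonempty disjoint subfamilies of $\mathcal P^e$; $\mathcal A(\mathsf P)=\{e\in\mathcal K:\mathsf P^e\in\mathcal G^e\}$. $\Psi$ is a family of subsets of $\mathcal K$, and $\mathcal P_\Psi=\{\mathsf P\in\mathcal P:\mathsf P^e\in\mathcal H^e\cup\mathcal G^e\ \forall e\in\mathcal K,\ \mathcal A(\mathsf P)\in\Psi\}$, $\mathcal H_0=\{\mathsf P\in\mathcal P:\mathsf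 P^e\in\mathcal H^e\ \forall e\}$, $\mathcal H_{\Psi,e}=\{\mathsf P\in\mathcal P_\Psi\setminus\mathcal H_0:e\notin\mathcal A(\mathsf P)\}$, $\mathcal G_{\Psi,e}=\{\mathsf P\in\mathcal P_\Psi:e\in\mathcal A(\mathsf P)\}$. Standing assumption: for every $e\in\mathcal K$, $\mathsf P\in\mathcal G_{\Psi,e}\cup\mathcal H_0$, $\mathsf Q\in\mathcal H_{\Psi,e}\cup\mathcal H_0$, $e\subseteq s\subseteq[K]$, $n\in\mathbb N$, $\mathsf P^s,\mathsf Q^s$ are mutually absolutely continuous on $\mathcal F_n^s$; $\Lambda_n(\mathsf P^s,\mathsf Q^s)=\frac{d\mathsf P^s}{d\mathsf Q^s}(\mathcal F_n^s)$, $Z_n=\log\Lambda_n$. Conditions (M) and (CC): for every $e\in\mathcal K$, $\mathsf P\in\mathcal G_{\Psi,e}$, $\mathsf Q\in\mathcal H_{\Psi,e}\cup\mathcal H_0$, $e\subseteq s\subseteq[K]$ there are positive numbers $\mathcal I(\mathsf P^s,\mathsf Q^s)$, $\mathcal I(\mathsf Q^s,\mathsf P^s)$ such that: (M) as $n\to\infty$, $\mathsf P(\max_{1\le m\le n}Z_m(\mathsf P^s,\mathsf Q^s)\ge n\rho)\to0$ for all $\rho>\mathcal I(\mathsf P^s,\mathsf Q^s)$ and $\mathsf Q(\max_{1\le m\le n}Z_m(\mathsf Q^s,\mathsf P^s)\ge n\rho)\to0$ for all $\rho>\mathcal I(\mathsf Q^s,\mathsf P^s)$; (CC) $\sum_{n\ge1}\mathsf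 P(Z_n(\mathsf P^s,\mathsf Q^s)<n\rho)<\infty$ for all $\rho<\mathcal I(\mathsf P^s,\mathsf Q^s)$ and $\sum_{n\ge1}\mathsf Q(Z_n(\mathsf Q^s,\mathsf P^s)<n\rho)<\infty$ for all $\rho<\mathcal I(\mathsf Q^s,\mathsf P^s)$. Notation: $\mathcal I(\mathsf P,\mathsf Q;s)=\mathcal I(\mathsf P^s,\mathsf Q^s)$, $\mathcal I(\mathsf P,\mathcal Q;s)=\min_{\mathsf Q\in\mathcal Q}\mathcal I(\mathsf P,\mathsf Q;s)$; $s$ is omitted when $s=[K]$. Statistics. Each unit has a detection subsystem $s_e$ and an isolation subsystem $s'_e$, $e\subseteq s_e\cap s'_e$, $s_e,s_e'\subseteq[K]$; $$\Lambda_{e,\rm det}(n)=\frac{\max\{\Lambda_n(\mathsf P,\mathsf P_0):\mathsf P\in\mathcal G_{\Psi,e}^{s_e}\}}{\max\{\Lambda_n(\mathsf P,\mathsf P_0):\mathsf P\in\mathcal H_0^{s_e}\}},\qquad \Lambda_{e,\rm iso}(n)=\frac{\max\{\Lambda_n(\mathsf P,\mathsf P_0'):\mathsf P\in\mathcal G_{\Psi,e}^{s'_e}\}}{\max\{\Lambda_n(\mathsf P,\mathsf P_0'):\mathsf P\in\mathcal H_{\Psi,e}^{s'_e}\}},$$ $\mathsf P_0\in\mathcal H_0^{s_e}$, $\mathsf P_0'\in\mathcal H_0^{s'_e}$ arbitrary (families over which maxima are taken are tacitly nonempty); $D_{\rm iso}(n)=\{e:\Lambda_{e,\rm iso}(n)>1\}$.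 Test classes. A test is $(T,D)$ with $T$ an $\{\mathcal F_n\}$-stopping time, $D$ $\mathcal F_T$-measurable and $\Psi$-valued. $\mathcal E_\Psi(\gamma,\delta)$: $\mathsf P(D\setminus\mathcal A(\mathsf P)\ne\emptyset)\le\gamma$, $\mathsf P(\mathcal A(\mathsf P)\setminus D\ne\emptyset)\le\delta$ on $\mathcal P_\Psi$. $\mathcal C_\Psi(\alpha,\beta,\gamma,\delta)$: $\mathsf P(D\ne\emptyset)\le\alpha$ on $\mathcal H_0$, and $\mathsf P(D=\emptyset)\le\beta$, $\mathsf P(D\setminus\mathcal A(\mathsf P)\ne\emptyset)\le\gamma$, $\mathsf P(\mathcal A(\mathsf P)\setminus D\ne\emptyset,D\ne\emptyset)\le\delta$ on $\mathcal P_\Psi\setminus\mathcal H_0$. Procedures ($\emptyset\in\Psi$): $T_0=\inf\{n:\Lambda_{e,\rm det}(n)\le1/C_e\ \forall e\}$; $T_{joint}=\inf\{n:\Lambda_{e,\rm det}(n)\ge D_e\text{ for some }e,\ \Lambda_{e,\rm iso}(n)\notin(1/A_e,B_e)\ \forall e,\ D_{\rm iso}(n)\in\Psi\setminus\{\emptyset\}\}$. $\chi^*$: $T^*=T_0\wedge T_{joint}$, $D^*=\emptyset$ if $T_0<T_{joint}$, $D^*=D_{\rm iso}(T^* )$ if $T_{joint}<T_0$. $\chi^*_{fwer}=(T^*_{fwer},D^*_{fwer})$: $\chi^*$ with $C_e=A_e$, $D_e=B_e$ for all $e$. Thresholds are functions of the levels in $(0,1)$ such that $\chi^*_{fwer}\in\mathcal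 E_\Psi(\gamma,\delta)$, $\chi^*\in\mathcal C_\Psi(\alpha,\beta,\gamma,\delta)$ for all levels, and for every $e$: $\log A_e\sim|\log\delta|$, $\log B_e\sim|\log\gamma|$, $\log C_e\sim|\log\beta|$, $\log D_e\sim|\log\alpha|$ as the corresponding levels go to $0$ (for $\chi^*_{fwer}$ only the relations for $A_e,B_e$ apply). $x\sim y$ means $x/y\to1$. Extrema over empty index sets are omitted. *)

theory Defs
  imports "HOL-Probability.Probability"
begin

text \<open>
  A path is a function on pairs (time, source), so that the random element \<open>X\<^sub>n\<^sup>k\<close> is the
  evaluation of a path at \<open>(n, k)\<close> and a distribution of \<open>X\<close> is a probability measure on the
  product space of all paths. The state space may depend on the source. Times start at 1.
\<close>

type_synonym 'b path = "nat \<times> nat \<Rightarrow> 'b"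

text \<open>A unit is a set of sources. The families \<open>nulls e\<close>, \<open>alts e\<close> consist of laws of \<open>X\<^sup>e\<close>.\<close>

record 'b model =
  nsrc :: nat
  state :: "nat \<Rightarrow> 'b measure"
  dists :: "'b path measure set"
  units :: "nat set set"
  nulls :: "nat set \<Rightarrow> 'b path measure set"
  alts :: "nat set \<Rightarrow> 'b path measure set"
  psi :: "nat set set set"

definition sources :: "'b model \<Rightarrow> nat set" where
  "sources M = {1..nsrc M}"

definition obs :: "enat \<Rightarrow> nat set \<Rightarrow> (nat \<times> nat) set" where
  "obs n s = {m. 1 \<le> m \<and> enat m \<le> n} \<times> s"

definition obs_space :: "'b model \<Rightarrow> enat \<Rightarrow> nat set \<Rightarrow> 'b path measure" where
  "obs_space M n s = PiM (obs n s) (\<lambda>(m, k). state M k)"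

abbreviation paths :: "'b model \<Rightarrow> nat set \<Rightarrow> 'b path measure" where
  "paths M s \<equiv> obs_space M \<infinity> s"

definition X :: "nat set \<Rightarrow> 'b path \<Rightarrow> 'b path" where
  "X s \<omega> = restrict \<omega> (obs \<infinity> s)"

definition law :: "'b model \<Rightarrow> nat set \<Rightarrow> 'b path measure \<Rightarrow> 'b path measure" where
  "law M s P = distr P (paths M s) (X s)"

text \<open>
  The sigma-algebra \<open>\<F>\<^sub>n\<^sup>s\<close>, on the space of \<open>s\<close>-paths. The value at \<open>\<infinity>\<close> is the sigma-algebra
  of all observations; it is needed because stopping times take values in \<^typ>\<open>enat\<close>.
\<close>

definition Fil :: "'b model \<Rightarrow> nat set \<Rightarrow> enat \<Rightarrow> 'b path measure" where
  "Fil M s n = vimage_algebra (space (paths M s)) (\<lambda>\<omega>. restrict \<omega> (obs n s)) (obs_space M n s)"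

text \<open>
  \<open>LR M s n R Q\<close> is the likelihood ratio \<open>\<Lambda>\<^sub>n(R, Q)\<close> of two laws \<open>R\<close>, \<open>Q\<close> on the space of
  \<open>s\<close>-paths, as a function of the complete path.
\<close>

definition LR ::
  "'b model \<Rightarrow> nat set \<Rightarrow> nat \<Rightarrow> 'b path measure \<Rightarrow> 'b path measure \<Rightarrow> 'b path \<Rightarrow> real" where
  "LR M s n R Q \<omega> =
     enn2real (RN_deriv (restr_to_subalg Q (Fil M s (enat n))) (restr_to_subalg R (Fil M s (enat n)))
       (X s \<omega>))"

definition Z ::
  "'b model \<Rightarrow> nat set \<Rightarrow> nat \<Rightarrow> 'b path measure \<Rightarrow> 'b path measure \<Rightarrow> 'b path \<Rightarrow> real" where
  "Z M s n R Q \<omega> = ln (LR M s n R Q \<omega>)"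

definition act :: "'b model \<Rightarrow> 'b path measure \<Rightarrow> nat set set" where
  "act M P = {e \<in> units M. law M e P \<in> alts M e}"

definition PPsi :: "'b model \<Rightarrow> 'b path measure set" where
  "PPsi M = {P \<in> dists M. (\<forall>e\<in>units M. law M e P \<in> nulls M e \<union> alts M e) \<and> act M P \<in> psi M}"

definition H0 :: "'b model \<Rightarrow> 'b path measure set" where
  "H0 M = {P \<in> dists M. \<forall>e\<in>units M. law M e P \<in> nulls M e}"

definition HPsi :: "'b model \<Rightarrow> nat set \<Rightarrow> 'b path measure set" where
  "HPsi M e = {P \<in> PPsi M - H0 M. e \<notin> act M P}"

definition GPsi :: "'b model \<Rightarrow> nat set \<Rightarrow> 'b path measure set" where
  "GPsi M e = {P \<in> PPsi M. e \<in> act M P}"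

definition valid_model :: "'b model \<Rightarrow> bool" where
  "valid_model M \<longleftrightarrow>
     finite (dists M) \<and>
     (\<forall>P\<in>dists M. prob_space P \<and> sets P = sets (paths M (sources M))) \<and>
     units M \<subseteq> Pow (sources M) \<and>
     (\<forall>e\<in>units M. nulls M e \<subseteq> law M e ` dists M \<and> alts M e \<subseteq> law M e ` dists M \<and>
        nulls M e \<noteq> {} \<and> alts M e \<noteq> {} \<and> nulls M e \<inter> alts M e = {}) \<and>
     psi M \<subseteq> Pow (units M)"

definition mutually_ac :: "'b model \<Rightarrow> bool" where
  "mutually_ac M \<longleftrightarrow>
     (\<forall>e\<in>units M. \<forall>P \<in> GPsi M e \<union> H0 M. \<forall>Q \<in> HPsi M e \<union> H0 M.
      \<forall>s. e \<subseteq> s \<and> s \<subseteq> sources M \<longrightarrow> (\<forall>n\<ge>1.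
        let P' = restr_to_subalg (law M s P) (Fil M s (enat n));
            Q' = restr_to_subalg (law M s Q) (Fil M s (enat n))
        in absolutely_continuous P' Q' \<and> absolutely_continuous Q' P'))"

text \<open>
  The information numbers are a function \<open>J\<close> of pairs of laws; only its values at the pairs
  occurring below are constrained.
\<close>

definition info_pos ::
  "'b model \<Rightarrow> ('b path measure \<Rightarrow> 'b path measure \<Rightarrow> real) \<Rightarrow> bool" where
  "info_pos M J \<longleftrightarrow>
     (\<forall>e\<in>units M. \<forall>P \<in> GPsi M e. \<forall>Q \<in> HPsi M e \<union> H0 M. \<forall>s. e \<subseteq> s \<and> s \<subseteq> sources M \<longrightarrow>
        0 < J (law M s P) (law M s Q) \<and> 0 < J (law M s Q) (law M s P))"

definition max_upcrossing ::
  "'b model \<Rightarrow> ('b path measure \<Rightarrow> 'b path measure \<Rightarrow> real) \<Rightarrow> nat set \<Rightarrow>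
   'b path measure \<Rightarrow> 'b path measure \<Rightarrow> bool" where
  "max_upcrossing M J s P Q \<longleftrightarrow>
     (\<forall>\<rho> > J (law M s P) (law M s Q).
        (\<lambda>n. measure P {\<omega> \<in> space P.
               (MAX m\<in>{1..n}. Z M s m (law M s P) (law M s Q) \<omega>) \<ge> real n * \<rho>})
        \<longlonglongrightarrow> 0)"

definition cond_M ::
  "'b model \<Rightarrow> ('b path measure \<Rightarrow> 'b path measure \<Rightarrow> real) \<Rightarrow> bool" where
  "cond_M M J \<longleftrightarrow>
     (\<forall>e\<in>units M. \<forall>P \<in> GPsi M e. \<forall>Q \<in> HPsi M e \<union> H0 M. \<forall>s. e \<subseteq> s \<and> s \<subseteq> sources M \<longrightarrow>
        max_upcrossing M J s P Q \<and> max_upcrossing M J s Q P)"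

definition complete_conv ::
  "'b model \<Rightarrow> ('b path measure \<Rightarrow> 'b path measure \<Rightarrow> real) \<Rightarrow> nat set \<Rightarrow>
   'b path measure \<Rightarrow> 'b path measure \<Rightarrow> bool" where
  "complete_conv M J s P Q \<longleftrightarrow>
     (\<forall>\<rho> < J (law M s P) (law M s Q).
        summable (\<lambda>n. measure P {\<omega> \<in> space P.
          Z M s (Suc n) (law M s P) (law M s Q) \<omega> < real (Suc n) * \<rho>}))"

definition cond_CC ::
  "'b model \<Rightarrow> ('b path measure \<Rightarrow> 'b path measure \<Rightarrow> real) \<Rightarrow> bool" where
  "cond_CC M J \<longleftrightarrow>
     (\<forall>e\<in>units M. \<forall>P \<in> GPsi M e. \<forall>Q \<in> HPsi M e \<union> H0 M. \<forall>s. e \<subseteq> s \<and> s \<subseteq> sources M \<longrightarrow>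
        complete_conv M J s P Q \<and> complete_conv M J s Q P)"

definition info ::
  "'b model \<Rightarrow> ('b path measure \<Rightarrow> 'b path measure \<Rightarrow> real) \<Rightarrow>
   'b path measure \<Rightarrow> 'b path measure set \<Rightarrow> nat set \<Rightarrow> real" where
  "info M J P \<Q> s = (MIN Q\<in>\<Q>. J (law M s P) (law M s Q))"

definition is_test :: "'b model \<Rightarrow> ('b path \<Rightarrow> enat) \<Rightarrow> ('b path \<Rightarrow> nat set set) \<Rightarrow> bool" where
  "is_test M T D \<longleftrightarrow>
     (\<forall>\<omega> \<in> space (paths M (sources M)). 1 \<le> T \<omega>) \<and>
     stopping_time (Fil M (sources M)) T \<and>
     D \<in> filtration.pre_sigma (space (paths M (sources M))) (Fil M (sources M)) T
           \<rightarrow>\<^sub>M count_space (psi M)"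

definition E_class ::
  "'b model \<Rightarrow> real \<Rightarrow> real \<Rightarrow> (('b path \<Rightarrow> enat) \<times> ('b path \<Rightarrow> nat set set)) set" where
  "E_class M \<gamma> \<delta> = {(T, D). is_test M T D \<and>
     (\<forall>P \<in> PPsi M.
        measure P {\<omega> \<in> space P. D \<omega> - act M P \<noteq> {}} \<le> \<gamma> \<and>
        measure P {\<omega> \<in> space P. act M P - D \<omega> \<noteq> {}} \<le> \<delta>)}"

definition C_class ::
  "'b model \<Rightarrow> real \<Rightarrow> real \<Rightarrow> real \<Rightarrow> real \<Rightarrow>
   (('b path \<Rightarrow> enat) \<times> ('b path \<Rightarrow> nat set set)) set" where
  "C_class M \<alpha> \<beta> \<gamma> \<delta> = {(T, D). is_test M T D \<and>
     (\<forall>P \<in> H0 M. measure P {\<omega> \<in> space P. D \<omega> \<noteq> {}} \<le> \<alpha>) \<and>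
     (\<forall>P \<in> PPsi M - H0 M.
        measure P {\<omega> \<in> space P. D \<omega> = {}} \<le> \<beta> \<and>
        measure P {\<omega> \<in> space P. D \<omega> - act M P \<noteq> {}} \<le> \<gamma> \<and>
        measure P {\<omega> \<in> space P. act M P - D \<omega> \<noteq> {} \<and> D \<omega> \<noteq> {}} \<le> \<delta>)}"

definition mean_time :: "'b path measure \<Rightarrow> ('b path \<Rightarrow> enat) \<Rightarrow> ennreal" where
  "mean_time P T = (\<integral>\<^sup>+ \<omega>. ennreal_of_enat (T \<omega>) \<partial>P)"

text \<open>
  For each unit, the detection and isolation subsystems and the reference laws \<open>P\<^sub>0\<close>, \<open>P\<^sub>0'\<close>
  in the denominators of the likelihood ratios.
\<close>

record 'b design =
  det_sub :: "nat set \<Rightarrow> nat set"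
  iso_sub :: "nat set \<Rightarrow> nat set"
  det_ref :: "nat set \<Rightarrow> 'b path measure"
  iso_ref :: "nat set \<Rightarrow> 'b path measure"

definition valid_design :: "'b model \<Rightarrow> 'b design \<Rightarrow> bool" where
  "valid_design M d \<longleftrightarrow> (\<forall>e\<in>units M.
     e \<subseteq> det_sub d e \<and> det_sub d e \<subseteq> sources M \<and>
     e \<subseteq> iso_sub d e \<and> iso_sub d e \<subseteq> sources M \<and>
     det_ref d e \<in> law M (det_sub d e) ` H0 M \<and>
     iso_ref d e \<in> law M (iso_sub d e) ` H0 M)"

definition Lam_det :: "'b model \<Rightarrow> 'b design \<Rightarrow> nat set \<Rightarrow> nat \<Rightarrow> 'b path \<Rightarrow> real" where
  "Lam_det M d e n \<omega> =
     (MAX R \<in> law M (det_sub d e) ` GPsi M e. LR M (det_sub d e) n R (det_ref d e) \<omega>) /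
     (MAX R \<in> law M (det_sub d e) ` H0 M. LR M (det_sub d e) n R (det_ref d e) \<omega>)"

definition Lam_iso :: "'b model \<Rightarrow> 'b design \<Rightarrow> nat set \<Rightarrow> nat \<Rightarrow> 'b path \<Rightarrow> real" where
  "Lam_iso M d e n \<omega> =
     (MAX R \<in> law M (iso_sub d e) ` GPsi M e. LR M (iso_sub d e) n R (iso_ref d e) \<omega>) /
     (MAX R \<in> law M (iso_sub d e) ` HPsi M e. LR M (iso_sub d e) n R (iso_ref d e) \<omega>)"

definition D_iso :: "'b model \<Rightarrow> 'b design \<Rightarrow> nat \<Rightarrow> 'b path \<Rightarrow> nat set set" where
  "D_iso M d n \<omega> = {e \<in> units M. Lam_iso M d e n \<omega> > 1}"

definition T_0 :: "'b model \<Rightarrow> 'b design \<Rightarrow> (nat set \<Rightarrow> real) \<Rightarrow> 'b path \<Rightarrow> enat" where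
  "T_0 M d C \<omega> = Inf {enat n | n. 1 \<le> n \<and> (\<forall>e\<in>units M. Lam_det M d e n \<omega> \<le> 1 / C e)}"

definition T_joint ::
  "'b model \<Rightarrow> 'b design \<Rightarrow> (nat set \<Rightarrow> real) \<Rightarrow> (nat set \<Rightarrow> real) \<Rightarrow> (nat set \<Rightarrow> real) \<Rightarrow>
   'b path \<Rightarrow> enat" where
  "T_joint M d A B D \<omega> = Inf {enat n | n. 1 \<le> n \<and>
     (\<exists>e\<in>units M. Lam_det M d e n \<omega> \<ge> D e) \<and>
     (\<forall>e\<in>units M. Lam_iso M d e n \<omega> \<notin> {1 / A e <..< B e}) \<and>
     D_iso M d n \<omega> \<in> psi M - {{}}}"

definition T_star ::
  "'b model \<Rightarrow> 'b design \<Rightarrow> (nat set \<Rightarrow> real) \<Rightarrow> (nat set \<Rightarrow> real) \<Rightarrow> (nat set \<Rightarrow> real) \<Rightarrow>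
   (nat set \<Rightarrow> real) \<Rightarrow> 'b path \<Rightarrow> enat" where
  "T_star M d A B C D \<omega> = min (T_0 M d C \<omega>) (T_joint M d A B D \<omega>)"

text \<open>
  A tie of \<open>T_0\<close> and \<open>T_joint\<close>, where we decide for the empty set, is possible only if both are
  infinite, as soon as all thresholds exceed 1.
\<close>

definition D_star ::
  "'b model \<Rightarrow> 'b design \<Rightarrow> (nat set \<Rightarrow> real) \<Rightarrow> (nat set \<Rightarrow> real) \<Rightarrow> (nat set \<Rightarrow> real) \<Rightarrow>
   (nat set \<Rightarrow> real) \<Rightarrow> 'b path \<Rightarrow> nat set set" where
  "D_star M d A B C D \<omega> =
     (if T_joint M d A B D \<omega> < T_0 M d C \<omega> then D_iso M d (the_enat (T_star M d A B C D \<omega>)) \<omega>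
      else {})"

abbreviation T_fwer ::
  "'b model \<Rightarrow> 'b design \<Rightarrow> (nat set \<Rightarrow> real) \<Rightarrow> (nat set \<Rightarrow> real) \<Rightarrow> 'b path \<Rightarrow> enat" where
  "T_fwer M d A B \<equiv> T_star M d A B A B"

abbreviation D_fwer ::
  "'b model \<Rightarrow> 'b design \<Rightarrow> (nat set \<Rightarrow> real) \<Rightarrow> (nat set \<Rightarrow> real) \<Rightarrow> 'b path \<Rightarrow> nat set set"
  where "D_fwer M d A B \<equiv> D_star M d A B A B"

text \<open>
  Asymptotic equivalence of quantities with values in \<open>[0, \<infinity>]\<close> (expectations may be infinite),
  which \<^const>\<open>asymp_equiv\<close> does not cover.
\<close>

definition ennreal_equiv :: "('a \<Rightarrow> ennreal) \<Rightarrow> 'a filter \<Rightarrow> ('a \<Rightarrow> ennreal) \<Rightarrow> bool" where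
  "ennreal_equiv f F g \<longleftrightarrow> ((\<lambda>x. f x / g x) \<longlongrightarrow> 1) F"

text \<open>Joint convergence of all levels to 0 from the right, at arbitrary relative rates.\<close>

definition levels2 :: "(real \<times> real) filter" where
  "levels2 = at_right 0 \<times>\<^sub>F at_right 0"

definition levels4 :: "(real \<times> real \<times> real \<times> real) filter" where
  "levels4 = at_right 0 \<times>\<^sub>F at_right 0 \<times>\<^sub>F at_right 0 \<times>\<^sub>F at_right 0"

text \<open>
  The first-order approximations of the expected sample sizes are written as one maximum over a union, so that
  the part indexed by \<open>units M - act M P\<close> drops out when this index set is empty.
\<close>

definition rate_fwer ::
  "'b model \<Rightarrow> ('b path measure \<Rightarrow> 'b path measure \<Rightarrow> real) \<Rightarrow> 'b path measure \<Rightarrow>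
   real \<Rightarrow> real \<Rightarrow> real" where
  "rate_fwer M J P \<gamma> \<delta> = Max (
     (\<lambda>e. \<bar>ln \<gamma>\<bar> / min (info M J P (H0 M) (sources M)) (info M J P (HPsi M e) (sources M)))
       ` act M P \<union>
     (\<lambda>e. \<bar>ln \<delta>\<bar> / info M J P (GPsi M e) (sources M)) ` (units M - act M P))"

definition rate_joint ::
  "'b model \<Rightarrow> ('b path measure \<Rightarrow> 'b path measure \<Rightarrow> real) \<Rightarrow> 'b path measure \<Rightarrow>
   real \<Rightarrow> real \<Rightarrow> real \<Rightarrow> real" where
  "rate_joint M J P \<alpha> \<gamma> \<delta> = Max (
     {\<bar>ln \<alpha>\<bar> / info M J P (H0 M) (sources M)} \<union>
     (\<lambda>e. \<bar>ln \<gamma>\<bar> / info M J P (HPsi M e) (sources M)) ` act M P \<union>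
     (\<lambda>e. \<bar>ln \<delta>\<bar> / info M J P (GPsi M e) (sources M)) ` (units M - act M P))"

end

theory Submission
  imports Defs
begin

text \<open>
  Both claims follow the same pattern: the rate is an asymptotic upper bound for the mean of the
  explicit procedure and an asymptotic lower bound for the mean of every test of the class. Since the
  procedure belongs to the class, the infimum over the class is caught between the two.

  Upper bound. Under \<open>P\<close> every statistic is driven by its true term. Reference laws
  cancel, so that whenever \<open>Z\<^sub>n(P, Q) \<ge> c > 0\<close> for all \<open>Q\<close> in the competing
  family, the corresponding log-statistic is at least \<open>c\<close> in the correct direction
  (\<open>Lam_det_ge\<close>, \<open>Lam_iso_ge\<close>, \<open>Lam_iso_le\<close>). If this happens at time \<open>n\<close> with
  \<open>c\<close> above all log-thresholds, then \<open>D_iso = act M P\<close> and the procedure has stopped. For a slope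
  below the information number, the probabilities that \<open>Z\<^sub>n\<close> lies below its line are summable by
  complete convergence. Hence the expected number of bad times is finite, and the mean is at most the
  time at which the lines cross the thresholds plus a constant that does not depend on the
  thresholds (\<open>mean_time_upper_bound\<close>, \<open>mean_time_T_star_le\<close>).

  Lower bound. Let \<open>Q\<close> be a law under which a decision is an error of probability at most
  \<open>\<kappa>\<close>, while this decision is likely under \<open>P\<close>. If the test stops by time \<open>N\<close> with this decision and
  the likelihood ratio has stayed below \<open>exp c\<close>, a change of measure bounds the probability under
  \<open>P\<close> by \<open>exp c * \<kappa>\<close>. With \<open>N\<close> slightly smaller than \<open>\<bar>ln \<kappa>\<bar> / J P Q\<close>, the ratio
  exceeds that level only with small probability by the maximal condition, so the test
  has probably not stopped by time \<open>N\<close> (\<open>early_stopping_bound\<close>, \<open>mean_time_lower_bound\<close>).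
  Each term of the rate arises from one choice of \<open>Q\<close> and of the decision
  (\<open>E_class_lower\<close>, \<open>C_class_lower\<close>).
\<close>

section \<open>Path spaces and the observation filtration\<close>

lemma X_measurable:
  assumes "sets P = sets (paths M (sources M))" "s \<subseteq> sources M"
  shows "X s \<in> P \<rightarrow>\<^sub>M paths M s"
proof -
  have "(\<lambda>\<omega>. restrict \<omega> (obs \<infinity> s)) \<in> paths M (sources M) \<rightarrow>\<^sub>M paths M s"
    unfolding obs_space_def using assms(2)
    by (intro measurable_restrict_subset) (auto simp: obs_def)
  then show ?thesis
    using assms(1) by (simp add: X_def[abs_def] cong: measurable_cong_sets)
qed

lemma X_sources_id: "\<omega> \<in> space (paths M (sources M)) \<Longrightarrow> X (sources M) \<omega> = \<omega>"
  by (auto simp: X_def obs_space_def space_PiM PiE_def extensional_restrict)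

lemma law_sources:
  assumes "sets P = sets (paths M (sources M))"
  shows "law M (sources M) P = P"
proof -
  have "law M (sources M) P = distr P (paths M (sources M)) (\<lambda>\<omega>. \<omega>)"
    unfolding law_def using sets_eq_imp_space_eq[OF assms]
    by (intro distr_cong) (auto simp: X_sources_id)
  then show ?thesis
    using assms by (simp add: distr_id2)
qed

lemma prob_space_law:
  assumes "prob_space P" "sets P = sets (paths M (sources M))" "s \<subseteq> sources M"
  shows "prob_space (law M s P)"
  unfolding law_def by (intro prob_space.prob_space_distr assms X_measurable)

lemma restrict_obs_measurable:
  "n \<le> m \<Longrightarrow> (\<lambda>\<omega>. restrict \<omega> (obs n s)) \<in> obs_space M m s \<rightarrow>\<^sub>M obs_space M n s"
  unfolding obs_space_def
  by (intro measurable_restrict_subset) (auto simp: obs_def dest: order_trans)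

lemma space_Fil: "space (Fil M s n) = space (paths M s)"
  by (simp add: Fil_def)

lemma sets_Fil_mono: 
  assumes "n \<le> m" shows "sets (Fil M s n) \<subseteq> sets (Fil M s m)"
proof -
  have "(\<lambda>\<omega>. restrict \<omega> (obs m s)) \<in> Fil M s m \<rightarrow>\<^sub>M obs_space M m s"
    unfolding Fil_def by (rule measurable_vimage_algebra1) 
       (use restrict_obs_measurable[of m \<infinity> s M] in \<open>auto simp: measurable_def\<close>)
  then have "(\<lambda>\<omega>. restrict (restrict \<omega> (obs m s)) (obs n s)) \<in> Fil M s m \<rightarrow>\<^sub>M obs_space M n s"
    by (rule measurable_compose) (rule restrict_obs_measurable[OF assms])
  moreover have "obs m s \<inter> obs n s = obs n s"
    using assms by (auto simp: obs_def dest: order_trans)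
  ultimately have "(\<lambda>\<omega>. restrict \<omega> (obs n s)) \<in> Fil M s m \<rightarrow>\<^sub>M obs_space M n s"
    by simp
  then show ?thesis
    unfolding Fil_def[of M s n] by (intro sets_image_in_sets) (auto simp: space_Fil)
qed

lemma subalgebra_Fil: "subalgebra (paths M s) (Fil M s n)"
proof -
  have "(\<lambda>\<omega>. restrict \<omega> (obs n s)) \<in> paths M s \<rightarrow>\<^sub>M obs_space M n s"
    by (rule restrict_obs_measurable) simp
  then show ?thesis
    unfolding subalgebra_def Fil_def by (auto simp: sets_image_in_sets)
qed

lemma filtration_Fil: "filtration (space (paths M s)) (Fil M s)"
  by unfold_locales (auto simp: space_Fil dest: sets_Fil_mono)

text \<open>
  The law of the first \<open>n\<close> observations, kept on the space of complete paths so that a likelihood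
  ratio is a Radon-Nikodym derivative between two measures with a common sigma-algebra.
\<close>

definition law_upto :: "'b model \<Rightarrow> nat set \<Rightarrow> nat \<Rightarrow> 'b path measure \<Rightarrow> 'b path measure" where
  "law_upto M s n P = restr_to_subalg (law M s P) (Fil M s (enat n))"

lemma subalgebra_law: "subalgebra (law M s P) (Fil M s n)"
  using subalgebra_Fil[of M s n] by (simp add: subalgebra_def law_def)

lemma sets_law_upto: "sets (law_upto M s n P) = sets (Fil M s (enat n))"
  unfolding law_upto_def by (rule sets_restr_to_subalg[OF subalgebra_law])

lemma space_law_upto: "space (law_upto M s n P) = space (paths M s)"
  by (simp add: law_upto_def space_restr_to_subalg law_def)

lemma prob_space_law_upto:
  assumes "prob_space P" "sets P = sets (paths M (sources M))" "s \<subseteq> sources M"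
  shows "prob_space (law_upto M s n P)"
  unfolding law_upto_def by (intro prob_space_restr_to_subalg subalgebra_law prob_space_law assms)

lemma LR_eq: "LR M s n (law M s R) (law M s Q) \<omega> =
    enn2real (RN_deriv (law_upto M s n Q) (law_upto M s n R) (X s \<omega>))"
  by (simp add: LR_def law_upto_def)

lemma LR_measurable:
  assumes "sets P = sets (paths M (sources M))" "s \<subseteq> sources M"
  shows "LR M s n (law M s R) (law M s Q) \<in> borel_measurable P"
proof -
  have "RN_deriv (law_upto M s n Q) (law_upto M s n R) \<in> borel_measurable (paths M s)"
    using borel_measurable_RN_deriv[of "law_upto M s n Q" "law_upto M s n R"] subalgebra_Fil[of M s "enat n"]
    by (auto simp: measurable_def sets_law_upto space_law_upto subalgebra_def)
  from measurable_compose[OF X_measurable[OF assms] this] show ?thesis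
    unfolding LR_eq[abs_def] by measurable
qed

lemma Z_measurable:
  assumes "sets P = sets (paths M (sources M))" "s \<subseteq> sources M"
  shows "Z M s n (law M s R) (law M s Q) \<in> borel_measurable P"
  unfolding Z_def[abs_def] using LR_measurable[OF assms, of n R Q] by measurable

lemma AE_law_upto:
  assumes "sets P = sets (paths M (sources M))" "s \<subseteq> sources M"
    "AE x in law_upto M s n P. \<phi> x"
  shows "AE \<omega> in P. \<phi> (X s \<omega>)"
proof -
  have "AE x in law M s P. \<phi> x"
    using assms(3) unfolding law_upto_def by (rule AE_restr_to_subalg[OF subalgebra_law])
  then show ?thesis
    unfolding law_def by (rule AE_distrD[OF X_measurable[OF assms(1,2)]])
qed

section \<open>Likelihood ratios\<close>

text \<open>
  Densities multiply: \<open>P\<close> has density \<open>RN_deriv Q P\<close> with respect to \<open>Q\<close>, which has density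
  \<open>RN_deriv R Q\<close> with respect to \<open>R\<close>; uniqueness of the density does the rest.
\<close>

lemma RN_deriv_chain:
  assumes "finite_measure P" "finite_measure Q" "finite_measure R"
    and sets: "sets Q = sets R" "sets P = sets R"
    and ac: "absolutely_continuous R Q" "absolutely_continuous Q P"
  shows "AE x in R. RN_deriv R P x = RN_deriv R Q x * RN_deriv Q P x"
proof -
  interpret P: finite_measure P by fact
  interpret Q: finite_measure Q by fact
  interpret R: finite_measure R by fact
  have [measurable]: "RN_deriv Q P \<in> borel_measurable R"
    using borel_measurable_RN_deriv[of Q P] sets by (simp cong: measurable_cong_sets)
  have "density R (\<lambda>x. RN_deriv R Q x * RN_deriv Q P x) = density (density R (RN_deriv R Q)) (RN_deriv Q P)"
    by (simp add: density_density_eq)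
  also have "\<dots> = P"
    using sets ac by (simp add: R.density_RN_deriv Q.density_RN_deriv)
  finally have "density R (\<lambda>x. RN_deriv R Q x * RN_deriv Q P x) = P" .
  from R.RN_deriv_unique[OF _ this] show ?thesis
    by (auto elim: eventually_mono)
qed

lemma AE_enn2real_RN_deriv_pos:
  assumes "finite_measure P" "finite_measure R" "sets P = sets R" "absolutely_continuous R P"
  shows "AE x in P. 0 < enn2real (RN_deriv R P x)"
proof -
  interpret P: finite_measure P by fact
  interpret R: finite_measure R by fact
  from R.real_RN_deriv[OF assms(1,4,3)] obtain D
    where D: "AE x in R. RN_deriv R P x = ennreal (D x)" "AE x in P. 0 < D x"
    by metis
  have "AE x in P. RN_deriv R P x = ennreal (D x)"
    using absolutely_continuous_AE[OF assms(3,4) D(1)] .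
  with D(2) show ?thesis
    by eventually_elim simp
qed

text \<open>
  This is what makes the reference law in the statistics arbitrary. The identity and the
  positivity hold almost everywhere for the laws of the first \<open>n\<close> observations, and are carried
  back to complete paths along \<open>X s\<close>.
\<close>

lemma LR_chain:
  assumes "\<And>P. P \<in> {P1, Q, R} \<Longrightarrow> prob_space P \<and> sets P = sets (paths M (sources M))"
    and s: "s \<subseteq> sources M"
    and ac: "absolutely_continuous (law_upto M s n R) (law_upto M s n Q)"
      "absolutely_continuous (law_upto M s n Q) (law_upto M s n P1)"
      "absolutely_continuous (law_upto M s n R) (law_upto M s n P1)"
  shows "AE \<omega> in P1. LR M s n (law M s P1) (law M s R) \<omega> =
            LR M s n (law M s Q) (law M s R) \<omega> * LR M s n (law M s P1) (law M s Q) \<omega>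
       \<and> 0 < LR M s n (law M s Q) (law M s R) \<omega>"
proof -
  let ?L = "law_upto M s n"
  have fin: "finite_measure (?L P)" if "P \<in> {P1, Q, R}" for P
    using prob_space_law_upto[OF _ _ s, of P n] assms(1)[OF that]
    by (simp add: prob_space_def)
  have eq: "sets (?L P) = sets (?L P')" for P P'
    by (simp add: sets_law_upto)
  have "AE x in ?L R. RN_deriv (?L R) (?L P1) x = RN_deriv (?L R) (?L Q) x * RN_deriv (?L Q) (?L P1) x"
    by (intro RN_deriv_chain fin eq ac) auto
  with ac(3) have 1: "AE x in ?L P1. RN_deriv (?L R) (?L P1) x = RN_deriv (?L R) (?L Q) x * RN_deriv (?L Q) (?L P1) x"
    using absolutely_continuous_AE eq by blast
  have "AE x in ?L Q. 0 < enn2real (RN_deriv (?L R) (?L Q) x)"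
    by (intro AE_enn2real_RN_deriv_pos fin eq ac) auto
  with ac(2) have 2: "AE x in ?L P1. 0 < enn2real (RN_deriv (?L R) (?L Q) x)"
    using absolutely_continuous_AE eq by blast
  from 1 2 have "AE x in ?L P1. enn2real (RN_deriv (?L R) (?L P1) x) = 
       enn2real (RN_deriv (?L R) (?L Q) x) * enn2real (RN_deriv (?L Q) (?L P1) x)
     \<and> 0 < enn2real (RN_deriv (?L R) (?L Q) x)"
    by eventually_elim (simp add: enn2real_mult)
  from AE_law_upto[OF _ s this] assms(1)[of P1] show ?thesis
    by (simp add: LR_eq)
qed

section \<open>Lower bound for the mean sample size by change of measure\<close>

lemma sets_Fil_subset: "A \<in> sets (Fil M s n) \<Longrightarrow> A \<in> sets (paths M s)"
  using subalgebra_Fil[of M s n] by (auto simp: subalgebra_def)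

text \<open>
  The sigma-algebra at the stopping time consists of the events whose intersection
  with \<open>T \<le> n\<close> is observable at time \<open>n\<close>.
\<close>

lemma is_testD_decision:
  assumes "is_test M T D"
  shows "{\<omega> \<in> space (paths M (sources M)). D \<omega> \<in> S \<and> T \<omega> \<le> n} \<in> sets (Fil M (sources M) n)"
proof -
  interpret filtration "space (paths M (sources M))" "Fil M (sources M)"
    by (rule filtration_Fil)
  from assms have T: "stopping_time (Fil M (sources M)) T"
    and D: "D \<in> pre_sigma T \<rightarrow>\<^sub>M count_space (psi M)"
    by (auto simp: is_test_def)
  have "D -` (S \<inter> psi M) \<inter> space (pre_sigma T) \<in> sets (pre_sigma T)"
    by (rule measurable_sets[OF D]) simp
  moreover have "D -` (S \<inter> psi M) \<inter> space (pre_sigma T) = {\<omega> \<in> space (paths M (sources M)). D \<omega> \<in> S}"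
    using measurable_space[OF D] by (auto simp: space_pre_sigma)
  ultimately have "{\<omega> \<in> space (paths M (sources M)). D \<omega> \<in> S} \<in> sets (pre_sigma T)"
    by simp
  from sets_pre_sigmaD[OF T this, of n] show ?thesis
    by (simp add: conj_assoc)
qed

lemma decision_measurable:
  assumes "is_test M T D" "sets P = sets (paths M (sources M))"
  shows "{\<omega> \<in> space P. D \<omega> \<in> S} \<in> sets P"
  using sets_Fil_subset[OF is_testD_decision[OF assms(1), of S \<infinity>]] assms(2)
    sets_eq_imp_space_eq[OF assms(2)] by simp

lemma stopping_measurable:
  assumes "is_test M T D" "sets P = sets (paths M (sources M))"
  shows "{\<omega> \<in> space P. T \<omega> \<le> n} \<in> sets P"
  using sets_Fil_subset[OF is_testD_decision[OF assms(1), of UNIV n]] assms(2)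
    sets_eq_imp_space_eq[OF assms(2)] by simp

lemma is_testD_stopped:
  assumes "is_test M T D" "1 \<le> m"
  shows "{\<omega> \<in> space (paths M (sources M)). D \<omega> \<in> S \<and> T \<omega> = enat m} \<in> sets (Fil M (sources M) (enat m))"
proof -
  let ?A = "\<lambda>m. {\<omega> \<in> space (paths M (sources M)). D \<omega> \<in> S \<and> T \<omega> \<le> enat m}"
  have "?A (m - 1) \<in> sets (Fil M (sources M) (enat m))"
    using is_testD_decision[OF assms(1), of S "enat (m - 1)"] sets_Fil_mono[of "enat (m - 1)" "enat m"]
    by auto
  then have "?A m - ?A (m - 1) \<in> sets (Fil M (sources M) (enat m))"
    using is_testD_decision[OF assms(1), of S "enat m"] by auto
  also have "x \<le> enat m \<and> \<not> x \<le> enat (m - 1) \<longleftrightarrow> x = enat m" for x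
    using assms(2) by (cases x) auto
  then have "?A m - ?A (m - 1) = {\<omega> \<in> space (paths M (sources M)). D \<omega> \<in> S \<and> T \<omega> = enat m}"
    by blast
  finally show ?thesis .
qed

definition source_law :: "'b model \<Rightarrow> 'b path measure \<Rightarrow> bool" where
  "source_law M P \<longleftrightarrow> prob_space P \<and> sets P = sets (paths M (sources M))"

lemma source_lawD:
  assumes "source_law M P"
  shows "prob_space P" "sets P = sets (paths M (sources M))" "space P = space (paths M (sources M))"
  using assms sets_eq_imp_space_eq by (auto simp: source_law_def)

text \<open>
  On an event observable at time \<open>n\<close>, \<open>P\<close> has density \<open>\<Lambda>\<^sub>n(P, Q)\<close> with respect to \<open>Q\<close>, and this density is
  at most \<open>exp c\<close> where its logarithm is below \<open>c\<close>. The convention \<open>ln 0 = 0\<close> is harmless here, as the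
  density is then zero.
\<close>

lemma change_of_measure:
  assumes P: "source_law M P" and Q: "source_law M Q"
    and ac: "absolutely_continuous (law_upto M (sources M) n Q) (law_upto M (sources M) n P)"
    and G: "G \<in> sets (Fil M (sources M) (enat n))"
  shows "measure P {\<omega> \<in> G. Z M (sources M) n (law M (sources M) P) (law M (sources M) Q) \<omega> < c}
    \<le> exp c * measure Q G"
proof -
  let ?S = "sources M"
  let ?P = "law_upto M ?S n P" and ?Q = "law_upto M ?S n Q"
  let ?F = "Fil M ?S (enat n)"
  interpret P: prob_space P using P by (rule source_lawD)
  interpret Q: prob_space Q using Q by (rule source_lawD)
  interpret P': prob_space ?P using P by (intro prob_space_law_upto) (auto dest: source_lawD)
  interpret Q': prob_space ?Q using Q by (intro prob_space_law_upto) (auto dest: source_lawD)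
  have setsL: "sets ?P = sets ?F" "sets ?Q = sets ?F"
    by (auto simp: sets_law_upto)
  have em: "emeasure (law_upto M ?S n R) A = emeasure R A" if "source_law M R" "A \<in> sets ?F" for R A
    using emeasure_restr_to_subalg[OF subalgebra_law that(2), of R] law_sources[OF source_lawD(2)[OF that(1)]]
    by (simp add: law_upto_def)
  have Gsub: "G \<subseteq> space (paths M ?S)"
    using sets.sets_into_space[OF G] by (simp add: space_Fil)
  let ?f = "RN_deriv ?Q ?P"
  define A where "A = {x \<in> space ?Q. ln (enn2real (?f x)) < c} \<inter> G"
  have A: "A \<in> sets ?Q"
  proof -
    have "{x \<in> space ?Q. ln (enn2real (?f x)) < c} \<in> sets ?Q"
      by measurable
    then show ?thesis using G by (auto simp: A_def setsL)
  qed
  have A_eq: "{\<omega> \<in> G. Z M ?S n (law M ?S P) (law M ?S Q) \<omega> < c} = A"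
    using Gsub by (auto simp: A_def Z_def LR_eq X_sources_id space_law_upto)
  have fin: "AE x in ?Q. ?f x \<noteq> \<infinity>"
    by (rule Q'.RN_deriv_finite) (use ac in \<open>auto simp: setsL P'.sigma_finite_measure\<close>)
  have "emeasure P A = emeasure ?P A"
    using A P by (simp add: em setsL)
  also have "\<dots> = emeasure (density ?Q ?f) A"
    using ac by (simp add: Q'.density_RN_deriv setsL)
  also have "\<dots> = (\<integral>\<^sup>+x. ?f x * indicator A x \<partial>?Q)"
    using A by (intro emeasure_density) auto
  also have "\<dots> \<le> (\<integral>\<^sup>+x. ennreal (exp c) * indicator A x \<partial>?Q)"
  proof (intro nn_integral_mono_AE, use fin in eventually_elim)
    fix x assume "?f x \<noteq> \<infinity>"
    then have *: "?f x = ennreal (enn2real (?f x))" by (simp add: less_top)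
    have "enn2real (?f x) \<le> exp c" if "x \<in> A"
    proof (cases "0 < enn2real (?f x)")
      case True
      moreover have "ln (enn2real (?f x)) < c"
        using that by (simp add: A_def)
      ultimately show ?thesis
        by (smt (verit) exp_ln exp_less_mono)
    next
      case False
      then show ?thesis by (smt (verit) exp_gt_zero)
    qed
    then show "?f x * indicator A x \<le> ennreal (exp c) * indicator A x"
      by (subst *) (auto simp: indicator_def ennreal_leI simp del: ennreal_enn2real_if)
  qed
  also have "\<dots> = ennreal (exp c) * emeasure ?Q A"
    using A by (simp add: nn_integral_cmult_indicator)
  also have "\<dots> \<le> ennreal (exp c) * emeasure ?Q G"
    using G by (intro mult_left_mono emeasure_mono) (auto simp: A_def setsL)
  also have "\<dots> = ennreal (exp c * measure Q G)"
    using G Q by (simp add: em Q.emeasure_eq_measure ennreal_mult)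
  finally show ?thesis
    by (simp add: A_eq P.emeasure_eq_measure ennreal_le_iff)
qed

text \<open>
  Early stopping forces one of three unlikely events: the decision is outside \<open>S\<close>, the log-likelihood
  ratio climbs to \<open>c\<close> by time \<open>N\<close>, or the test decides in \<open>S\<close> while the ratio is still below \<open>c\<close>. The last
  event splits according to the value of \<open>T\<close>, and each piece is transferred to \<open>Q\<close>.
\<close>

lemma early_stopping_bound:
  assumes P: "source_law M P" and Q: "source_law M Q" and test: "is_test M T D"
    and ac: "\<And>n. 1 \<le> n \<Longrightarrow> absolutely_continuous (law_upto M (sources M) n Q) (law_upto M (sources M) n P)"
    and N: "1 \<le> N"
  shows "measure P {\<omega> \<in> space P. T \<omega> \<le> enat N} \<le>
      measure P {\<omega> \<in> space P. D \<omega> \<notin> S}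
    + measure P {\<omega> \<in> space P.
        (MAX m\<in>{1..N}. Z M (sources M) m (law M (sources M) P) (law M (sources M) Q) \<omega>) \<ge> c}
    + exp c * measure Q {\<omega> \<in> space Q. D \<omega> \<in> S}"
proof -
  let ?S = "sources M"
  let ?Z = "\<lambda>m. Z M ?S m (law M ?S P) (law M ?S Q)"
  interpret P: prob_space P using P by (rule source_lawD)
  interpret Q: prob_space Q using Q by (rule source_lawD)
  note sp = source_lawD[OF P] source_lawD[OF Q]
  have Zm[measurable]: "?Z m \<in> borel_measurable P" for m
    by (rule Z_measurable) (auto simp: sp)
  define G where "G m = {\<omega> \<in> space (paths M ?S). D \<omega> \<in> S \<and> T \<omega> = enat m}" for m
  have G: "G m \<in> sets (Fil M ?S (enat m))" if "1 \<le> m" for m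
    unfolding G_def by (rule is_testD_stopped[OF test that])
  have GP: "G m \<in> sets P" "G m \<in> sets Q" if "1 \<le> m" for m
    using sets_Fil_subset[OF G[OF that]] by (simp_all add: sp)
  define Bad where "Bad = {\<omega> \<in> space P. (MAX m\<in>{1..N}. ?Z m \<omega>) \<ge> c}"
  have Bad_eq: "Bad = (\<Union>m\<in>{1..N}. {\<omega> \<in> space P. ?Z m \<omega> \<ge> c})"
    using N by (auto simp: Bad_def Max_ge_iff)
  have Bad: "Bad \<in> sets P"
    unfolding Bad_eq by measurable
  have Wrong: "{\<omega> \<in> space P. D \<omega> \<notin> S} \<in> sets P"
    using decision_measurable[OF test sp(2), of "- S"] by simp
  \<comment> \<open>The part of the event \<open>T = m\<close> on which the change of measure at time \<open>m\<close> is cheap.\<close>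
  let ?H = "\<lambda>m. {\<omega> \<in> G m. ?Z m \<omega> < c}"
  have H: "?H m \<in> sets P" if "1 \<le> m" for m
  proof -
    have "?H m = G m \<inter> {\<omega> \<in> space P. ?Z m \<omega> < c}"
      by (auto simp: G_def sp)
    then show ?thesis using GP(1)[OF that] by simp
  qed
  have "{\<omega> \<in> space P. T \<omega> \<le> enat N} \<subseteq> {\<omega> \<in> space P. D \<omega> \<notin> S} \<union> Bad \<union> (\<Union>m\<in>{1..N}. ?H m)"
  proof
    fix \<omega> assume *: "\<omega> \<in> {\<omega> \<in> space P. T \<omega> \<le> enat N}"
    moreover have "1 \<le> T \<omega>"
      using test * by (auto simp: is_test_def sp)
    ultimately obtain m where m: "T \<omega> = enat m" "m \<in> {1..N}"
      by (cases "T \<omega>") (auto simp: one_enat_def)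
    then show "\<omega> \<in> {\<omega> \<in> space P. D \<omega> \<notin> S} \<union> Bad \<union> (\<Union>m\<in>{1..N}. ?H m)"
      using * unfolding Bad_eq by (force simp: G_def sp)
  qed
  then have "measure P {\<omega> \<in> space P. T \<omega> \<le> enat N} \<le> measure P ({\<omega> \<in> space P. D \<omega> \<notin> S} \<union> Bad \<union> (\<Union>m\<in>{1..N}. ?H m))"
    by (intro P.finite_measure_mono sets.Un sets.finite_UN Wrong Bad H) auto
  also have "\<dots> \<le> measure P {\<omega> \<in> space P. D \<omega> \<notin> S} + measure P Bad + measure P (\<Union>m\<in>{1..N}. ?H m)"
    by (intro order_trans[OF measure_Un_le] add_mono order_refl 
       measure_Un_le sets.Un sets.finite_UN Wrong Bad H) auto
  also have "measure P (\<Union>m\<in>{1..N}. ?H m) \<le> (\<Sum>m\<in>{1..N}. measure P (?H m))"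
    by (intro P.finite_measure_subadditive_finite) (use H in auto)
  also have "\<dots> \<le> (\<Sum>m\<in>{1..N}. exp c * measure Q (G m))"
    by (intro sum_mono change_of_measure P Q ac G) auto
  also have "\<dots> = exp c * measure Q (\<Union>m\<in>{1..N}. G m)"
    by (subst Q.finite_measure_finite_Union)
       (use GP in \<open>auto simp: sum_distrib_left disjoint_family_on_def G_def\<close>)
  also have "measure Q (\<Union>m\<in>{1..N}. G m) \<le> measure Q {\<omega> \<in> space Q. D \<omega> \<in> S}"
    by (intro Q.finite_measure_mono decision_measurable[OF test]) (auto simp: G_def sp)
  finally show ?thesis
    by (simp add: Bad_def)
qed

lemma mean_time_ge:
  assumes P: "source_law M P" and test: "is_test M T D"
    and x: "measure P {\<omega> \<in> space P. T \<omega> \<le> enat N} \<le> x"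
  shows "ennreal (real (Suc N) * (1 - x)) \<le> mean_time P T"
proof -
  interpret P: prob_space P using P by (rule source_lawD)
  have m: "{\<omega> \<in> space P. T \<omega> \<le> enat N} \<in> sets P"
    by (rule stopping_measurable[OF test source_lawD(2)[OF P]])
  let ?A = "space P - {\<omega> \<in> space P. T \<omega> \<le> enat N}"
  have "1 - x \<le> measure P ?A"
    using P.prob_compl[OF m] x by simp
  then have "real (Suc N) * (1 - x) \<le> real (Suc N) * measure P ?A"
    by (intro mult_left_mono) auto
  then have "ennreal (real (Suc N) * (1 - x)) \<le> ennreal (real (Suc N)) * emeasure P ?A"
    unfolding P.emeasure_eq_measure by (subst ennreal_mult'[symmetric]) (auto intro: ennreal_leI)
  also have "\<dots> = (\<integral>\<^sup>+\<omega>. ennreal (real (Suc N)) * indicator ?A \<omega> \<partial>P)"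
    using m by (subst nn_integral_cmult_indicator) auto
  also have "\<dots> \<le> mean_time P T"
    unfolding mean_time_def
  proof (intro nn_integral_mono)
    fix \<omega> assume "\<omega> \<in> space P"
    show "ennreal (real (Suc N)) * indicator ?A \<omega> \<le> ennreal_of_enat (T \<omega>)"
    proof (cases "\<omega> \<in> ?A")
      case True
      then have "enat (Suc N) \<le> T \<omega>"
        by (simp add: Suc_ile_eq not_le)
      then have "ennreal_of_enat (enat (Suc N)) \<le> ennreal_of_enat (T \<omega>)"
        by (simp only: ennreal_of_enat_le_iff)
      with True show ?thesis
        by (simp add: ennreal_of_nat_eq_real_of_nat)
    qed simp
  qed
  finally show ?thesis .
qed

text \<open>
  The bound is uniform over all tests, sets of decisions and levels \<open>\<kappa>\<close> with \<open>\<bar>ln \<kappa>\<bar> \<ge> L\<close>; this is what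
  allows the infimum over a class to be taken afterwards. The horizon \<open>N\<close> is the integer
  part of \<open>(1 - \<epsilon> / 2) * \<bar>ln \<kappa>\<bar> / I\<close> and the slope \<open>\<rho>\<close> is slightly above \<open>I\<close>, so that the level \<open>N * \<rho>\<close> is
  at most \<open>(1 - c) * \<bar>ln \<kappa>\<bar>\<close> for some \<open>c > 0\<close>, and the transferred error probability
  \<open>exp (N * \<rho>) * \<kappa>\<close> vanishes.
\<close>

lemma mean_time_lower_bound:
  fixes J :: "'b path measure \<Rightarrow> 'b path measure \<Rightarrow> real"
  assumes P: "source_law M P" and Q: "source_law M Q"
    and ac: "\<And>n. 1 \<le> n \<Longrightarrow> absolutely_continuous (law_upto M (sources M) n Q) (law_upto M (sources M) n P)"
    and I: "I = J (law M (sources M) P) (law M (sources M) Q)" "0 < I"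
    and up: "max_upcrossing M J (sources M) P Q"
    and \<epsilon>: "0 < \<epsilon>" "\<epsilon> < 1"
  obtains L \<eta> where "0 < \<eta>" and
    "\<And>T D S \<kappa>. is_test M T D \<Longrightarrow> 0 < \<kappa> \<Longrightarrow> \<kappa> < 1 \<Longrightarrow> L \<le> \<bar>ln \<kappa>\<bar> \<Longrightarrow>
       measure Q {\<omega> \<in> space Q. D \<omega> \<in> S} \<le> \<kappa> \<Longrightarrow> measure P {\<omega> \<in> space P. D \<omega> \<notin> S} \<le> \<eta> \<Longrightarrow>
       ennreal ((1 - \<epsilon>) * (\<bar>ln \<kappa>\<bar> / I)) \<le> mean_time P T"
proof -
  let ?Z = "\<lambda>m. Z M (sources M) m (law M (sources M) P) (law M (sources M) Q)"
  define a \<eta> \<rho> where "a = 1 - \<epsilon> / 2" and "\<eta> = \<epsilon> / 6" and "\<rho> = I / (1 - \<epsilon> / 4)"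
  have \<rho>: "I < \<rho>"
    using \<epsilon> I by (simp add: \<rho>_def field_simps)
  define c where "c = 1 - a / (1 - \<epsilon> / 4)"
  have c: "0 < c"
    using \<epsilon> by (simp add: c_def a_def field_simps)
  define N where "N l = nat \<lfloor>a * l / I\<rfloor>" for l
  have a: "0 < a" using \<epsilon> by (simp add: a_def)
  have N_lim: "filterlim N sequentially at_top"
  proof -
    have "filterlim (\<lambda>l. a / I * l) at_top at_top"
      using a I by (intro filterlim_tendsto_pos_mult_at_top[OF tendsto_const] filterlim_ident) auto
    then have "filterlim (\<lambda>l. nat \<lfloor>a / I * l\<rfloor>) sequentially at_top"
      by (intro filterlim_compose[OF filterlim_nat_sequentially] filterlim_compose[OF filterlim_floor_sequentially])
    then show ?thesis by (simp add: N_def[abs_def])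
  qed
  have "((\<lambda>n. measure P {\<omega> \<in> space P. (MAX m\<in>{1..n}. ?Z m \<omega>) \<ge> real n * \<rho>}) \<longlongrightarrow> 0) sequentially"
    using up \<rho> I(1) by (auto simp: max_upcrossing_def)
  from filterlim_compose[OF this N_lim]
  have "eventually (\<lambda>l. measure P {\<omega> \<in> space P. (MAX m\<in>{1..N l}. ?Z m \<omega>) \<ge> real (N l) * \<rho>} < \<eta>) at_top"
    using \<epsilon> by (intro order_tendstoD(2)) (auto simp: \<eta>_def)
  moreover have "eventually (\<lambda>l. 1 \<le> N l) at_top"
    using N_lim by (auto simp: filterlim_at_top)
  moreover have "((\<lambda>l. exp (- (c * l))) \<longlongrightarrow> 0) at_top"
    using c by (auto intro!: filterlim_compose[OF exp_at_bot] filterlim_tendsto_pos_mult_at_top[OF tendsto_const]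
        filterlim_ident simp: filterlim_uminus_at_bot)
  then have "eventually (\<lambda>l. exp (- (c * l)) < \<eta>) at_top"
    using \<epsilon> by (intro order_tendstoD(2)) (auto simp: \<eta>_def)
  ultimately have "eventually (\<lambda>l. measure P {\<omega> \<in> space P. (MAX m\<in>{1..N l}. ?Z m \<omega>) \<ge> real (N l) * \<rho>} < \<eta>
     \<and> 1 \<le> N l \<and> exp (- (c * l)) < \<eta>) at_top"
    by eventually_elim auto
  then obtain L where L: "\<And>l. L \<le> l \<Longrightarrow> measure P {\<omega> \<in> space P. (MAX m\<in>{1..N l}. ?Z m \<omega>) \<ge> real (N l) * \<rho>} < \<eta>
     \<and> 1 \<le> N l \<and> exp (- (c * l)) < \<eta>"
    by (auto simp: eventually_at_top_linorder)
  show ?thesis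
  proof (rule that[of \<eta> L])
    show "0 < \<eta>" using \<epsilon> by (simp add: \<eta>_def)
    fix T D S \<kappa>
    assume test: "is_test M T D" and \<kappa>: "0 < \<kappa>" "\<kappa> < 1" and l: "L \<le> \<bar>ln \<kappa>\<bar>"
      and QD: "measure Q {\<omega> \<in> space Q. D \<omega> \<in> S} \<le> \<kappa>" and PD: "measure P {\<omega> \<in> space P. D \<omega> \<notin> S} \<le> \<eta>"
    let ?l = "\<bar>ln \<kappa>\<bar>"
    have \<kappa>_eq: "\<kappa> = exp (- ?l)"
      using \<kappa> by (simp add: abs_if)
    have "real (N ?l) \<le> a * ?l / I"
      unfolding N_def using a I(2) by (simp add: of_nat_floor)
    then have "real (N ?l) * \<rho> \<le> a * ?l / I * \<rho>"
      using I(2) \<rho> by (intro mult_right_mono) auto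
    also have "\<dots> = (1 - c) * ?l"
      using I(2) by (simp add: c_def \<rho>_def)
    finally have "real (N ?l) * \<rho> \<le> (1 - c) * ?l" .
    then have "exp (real (N ?l) * \<rho>) * measure Q {\<omega> \<in> space Q. D \<omega> \<in> S} \<le> exp ((1 - c) * ?l) * exp (- ?l)"
      using QD by (intro mult_mono) (auto simp: \<kappa>_eq[symmetric])
    also have "\<dots> = exp (- (c * ?l))"
      by (simp add: exp_add[symmetric] algebra_simps)
    finally have "measure P {\<omega> \<in> space P. T \<omega> \<le> enat (N ?l)} \<le> 3 * \<eta>"
      using early_stopping_bound[OF P Q test ac, of "N ?l" S "real (N ?l) * \<rho>"] L[OF l] PD by simp
    from mean_time_ge[OF P test this]
    have "ennreal (real (Suc (N ?l)) * (1 - 3 * \<eta>)) \<le> mean_time P T" .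
    moreover have "a * ?l / I \<le> real (Suc (N ?l))"
      unfolding N_def by linarith
    then have "a * ?l / I * a \<le> real (Suc (N ?l)) * (1 - 3 * \<eta>)"
      using a by (intro mult_mono) (auto simp: a_def \<eta>_def)
    moreover have "(1 - \<epsilon>) * (?l / I) \<le> a * ?l / I * a"
    proof -
      have "1 - \<epsilon> \<le> a * a" by (simp add: a_def field_simps)
      then have "(1 - \<epsilon>) * (?l / I) \<le> (a * a) * (?l / I)"
        using I(2) by (intro mult_right_mono) auto
      then show ?thesis by (simp add: mult_ac)
    qed
    ultimately show "ennreal ((1 - \<epsilon>) * (?l / I)) \<le> mean_time P T"
      by (meson ennreal_leI order_trans)
  qed
qed

section \<open>Upper bound for the mean sample size by counting bad times\<close>

text \<open>
  Positivity of \<open>c\<close> matters: it excludes a vanishing likelihood ratio, whose logarithm is \<open>0\<close> by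
  convention.
\<close>

lemma LR_dominates:
  assumes P: "source_law M P" and Q: "source_law M Q" and R: "source_law M R"
    and s: "s \<subseteq> sources M"
    and ac: "absolutely_continuous (law_upto M s n R) (law_upto M s n Q)"
      "absolutely_continuous (law_upto M s n Q) (law_upto M s n P)"
      "absolutely_continuous (law_upto M s n R) (law_upto M s n P)"
  shows "AE \<omega> in P. \<forall>c>0. c \<le> Z M s n (law M s P) (law M s Q) \<omega> \<longrightarrow>
      0 < LR M s n (law M s Q) (law M s R) \<omega> \<and>
      exp c * LR M s n (law M s Q) (law M s R) \<omega> \<le> LR M s n (law M s P) (law M s R) \<omega>"
proof -
  have "AE \<omega> in P. LR M s n (law M s P) (law M s R) \<omega> =
            LR M s n (law M s Q) (law M s R) \<omega> * LR M s n (law M s P) (law M s Q) \<omega>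
       \<and> 0 < LR M s n (law M s Q) (law M s R) \<omega>"
    using P Q R by (intro LR_chain s ac) (auto dest: source_lawD)
  then show ?thesis
  proof (eventually_elim, intro allI impI conjI)
    fix \<omega> c
    let ?l = "LR M s n (law M s P) (law M s Q) \<omega>"
    assume *: "LR M s n (law M s P) (law M s R) \<omega> = LR M s n (law M s Q) (law M s R) \<omega> * ?l
       \<and> 0 < LR M s n (law M s Q) (law M s R) \<omega>"
      and c: "0 < c" "c \<le> Z M s n (law M s P) (law M s Q) \<omega>"
    have "0 \<le> ?l"
      by (simp add: LR_def)
    moreover have "?l \<noteq> 0"
      using c by (auto simp: Z_def)
    ultimately have "exp c \<le> ?l"
      using c by (simp add: Z_def ln_ge_iff)
    with * show "exp c * LR M s n (law M s Q) (law M s R) \<omega> \<le> LR M s n (law M s P) (law M s R) \<omega>"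
      by simp
    show "0 < LR M s n (law M s Q) (law M s R) \<omega>" using * by simp
  qed
qed

lemma Max_ratio_ge:
  fixes f :: "'a \<Rightarrow> real"
  assumes "finite G" "finite H" "H \<noteq> {}" "x \<in> G"
    and "\<And>h. h \<in> H \<Longrightarrow> 0 < f h \<and> k * f h \<le> f x"
  shows "k \<le> Max (f ` G) / Max (f ` H)"
proof -
  have "Max (f ` H) \<in> f ` H"
    using assms(2,3) by (intro Max_in) auto
  then obtain h where h: "h \<in> H" "Max (f ` H) = f h"
    by auto
  have "f x \<le> Max (f ` G)"
    using assms(1,4) by (intro Max_ge) auto
  then show ?thesis
    using assms(5)[OF h(1)] h(2) by (simp add: pos_le_divide_eq)
qed

lemma Max_ratio_le:
  fixes f :: "'a \<Rightarrow> real"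
  assumes "finite G" "finite H" "G \<noteq> {}" "x \<in> H" "0 < k"
    and "\<And>g. g \<in> G \<Longrightarrow> 0 < f g \<and> k * f g \<le> f x"
  shows "Max (f ` G) / Max (f ` H) \<le> 1 / k"
proof -
  have "k \<le> Max (f ` H) / Max (f ` G)"
    by (rule Max_ratio_ge) (use assms in auto)
  then have "1 / (Max (f ` H) / Max (f ` G)) \<le> 1 / k"
    using assms(5) by (intro divide_left_mono mult_pos_pos) auto
  then show ?thesis by simp
qed

text \<open>
  From time \<open>N\<close> on, the clock can only run while \<open>b\<close> holds. Bad times are indexed from zero, which is
  why a good index \<open>n\<close> stops the clock by \<open>Suc n\<close>.
\<close>

lemma enat_time_le_bad_count:
  fixes T :: enat and b :: "nat \<Rightarrow> bool"
  assumes "\<And>n. N \<le> n \<Longrightarrow> \<not> b n \<Longrightarrow> T \<le> enat (Suc n)"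
  shows "ennreal_of_enat T \<le> of_nat (Suc N) + (\<Sum>n. of_bool (b n))"
proof -
  have count: "of_nat k \<le> (\<Sum>n. of_bool (b n) :: ennreal)" if "\<And>n. N \<le> n \<Longrightarrow> n < N + k \<Longrightarrow> b n" for k
  proof -
    have "of_nat k = (\<Sum>n\<in>{N..<N + k}. of_bool (b n) :: ennreal)"
      using that by simp
    also have "\<dots> \<le> (\<Sum>n. of_bool (b n))"
      by (intro sum_le_suminf) auto
    finally show ?thesis .
  qed
  show ?thesis
  proof (cases "\<exists>n\<ge>N. \<not> b n")
    case True
    define n where "n = (LEAST n. N \<le> n \<and> \<not> b n)"
    have n: "N \<le> n" "\<not> b n"
      using LeastI_ex[of "\<lambda>n. N \<le> n \<and> \<not> b n"] True by (auto simp: n_def)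
    have least: "b m" if "N \<le> m" "m < n" for m
      using not_less_Least[of m "\<lambda>n. N \<le> n \<and> \<not> b n"] that by (auto simp: n_def)
    have "ennreal_of_enat T \<le> ennreal_of_enat (enat (Suc n))"
      using assms[OF n] by (simp only: ennreal_of_enat_le_iff)
    also have "\<dots> = of_nat (Suc N) + of_nat (n - N)"
      using n(1) by (simp flip: of_nat_add)
    also have "\<dots> \<le> of_nat (Suc N) + (\<Sum>n. of_bool (b n))"
      using n(1) least by (intro add_left_mono count) auto
    finally show ?thesis .
  next
    case False
    then have le: "of_nat k \<le> (\<Sum>n. of_bool (b n) :: ennreal)" for k
      by (intro count) auto
    have "(\<Sum>n. of_bool (b n) :: ennreal) = top"
    proof (rule ccontr)
      assume "(\<Sum>n. of_bool (b n) :: ennreal) \<noteq> top"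
      then obtain k where "(\<Sum>n. of_bool (b n) :: ennreal) < of_nat k"
        using ennreal_Ex_less_of_nat[of "\<Sum>n. of_bool (b n)"] by (auto simp: less_top)
      with le[of k] show False by simp
    qed
    then show ?thesis by simp
  qed
qed

text \<open>
  The constant is one plus the sum, over all times and all pairs of laws, of the probability that the
  log-likelihood ratio lies below its line, which bounds the expected number of bad times; complete
  convergence makes it finite. It is the same for all stopping rules \<open>T\<close> and times \<open>N\<close>. Counting bad times instead of waiting for the last one keeps \<open>T\<close>
  out of all measurability questions.
\<close>

lemma mean_time_upper_bound:
  fixes J :: "'b path measure \<Rightarrow> 'b path measure \<Rightarrow> real"
    and K :: "(nat set \<times> 'b path measure \<times> real) set"
  assumes P: "source_law M P" and K: "finite K"
    and conv: "\<And>s Q \<rho>. (s, Q, \<rho>) \<in> K \<Longrightarrow>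
      s \<subseteq> sources M \<and> complete_conv M J s P Q \<and> \<rho> < J (law M s P) (law M s Q)"
  obtains C where "0 \<le> C" and
    "\<And>T N. (AE \<omega> in P. \<forall>n\<ge>N. 1 \<le> n \<longrightarrow>
         (\<forall>(s, Q, \<rho>)\<in>K. real n * \<rho> \<le> Z M s n (law M s P) (law M s Q) \<omega>) \<longrightarrow> T \<omega> \<le> enat n) \<Longrightarrow>
       mean_time P T \<le> ennreal (real N + C)"
proof -
  interpret P: prob_space P using P by (rule source_lawD)
  define B where "B n = (\<lambda>(s, Q, \<rho>). {\<omega> \<in> space P. Z M s (Suc n) (law M s P) (law M s Q) \<omega> < real (Suc n) * \<rho>})" for n
  have B[measurable]: "B n k \<in> sets P" if "k \<in> K" for n k
  proof -
    obtain s Q \<rho> where k: "k = (s, Q, \<rho>)" by (cases k)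
    have [measurable]: "Z M s (Suc n) (law M s P) (law M s Q) \<in> borel_measurable P"
      using conv that P by (intro Z_measurable) (auto simp: k dest: source_lawD)
    show ?thesis by (simp add: B_def k)
  qed
  have sum: "summable (\<lambda>n. measure P (B n k))" if "k \<in> K" for k
  proof -
    obtain s Q \<rho> where k: "k = (s, Q, \<rho>)" by (cases k)
    show ?thesis
      using conv[of s Q \<rho>] that by (auto simp: k B_def complete_conv_def)
  qed
  define C where "C = 1 + (\<Sum>n. \<Sum>k\<in>K. measure P (B n k))"
  have sumK: "summable (\<lambda>n. \<Sum>k\<in>K. measure P (B n k))"
    using sum by (rule summable_sum)
  have nonneg: "0 \<le> (\<Sum>n. \<Sum>k\<in>K. measure P (B n k))"
    by (intro suminf_nonneg sumK sum_nonneg) auto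
  show ?thesis
  proof (rule that[of C])
    show "0 \<le> C" using nonneg by (simp add: C_def)
    fix T N
    assume T: "AE \<omega> in P. \<forall>n\<ge>N. 1 \<le> n \<longrightarrow>
         (\<forall>(s, Q, \<rho>)\<in>K. real n * \<rho> \<le> Z M s n (law M s P) (law M s Q) \<omega>) \<longrightarrow> T \<omega> \<le> enat n"
    let ?U = "\<lambda>n. \<Union>k\<in>K. B n k"
    have U[measurable]: "?U n \<in> sets P" for n
      using K B by auto
    have "mean_time P T \<le> (\<integral>\<^sup>+\<omega>. of_nat (Suc N) + (\<Sum>n. indicator (?U n) \<omega>) \<partial>P)"
      unfolding mean_time_def
    proof (intro nn_integral_mono_AE, use T AE_space in eventually_elim)
      fix \<omega>
      assume 1: "\<forall>n\<ge>N. 1 \<le> n \<longrightarrow>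
         (\<forall>(s, Q, \<rho>)\<in>K. real n * \<rho> \<le> Z M s n (law M s P) (law M s Q) \<omega>) \<longrightarrow> T \<omega> \<le> enat n"
        and "\<omega> \<in> space P"
      have "T \<omega> \<le> enat (Suc n)" if "N \<le> n" "\<omega> \<notin> ?U n" for n
      proof -
        have "\<forall>(s, Q, \<rho>)\<in>K. real (Suc n) * \<rho> \<le> Z M s (Suc n) (law M s P) (law M s Q) \<omega>"
          using that(2) \<open>\<omega> \<in> space P\<close> by (force simp: B_def not_less)
        with 1 that(1) show ?thesis by auto
      qed
      from enat_time_le_bad_count[where b = "\<lambda>n. \<omega> \<in> ?U n", OF this]
      show "ennreal_of_enat (T \<omega>) \<le> of_nat (Suc N) + (\<Sum>n. indicator (?U n) \<omega>)"
        by (simp add: indicator_def)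
    qed
    also have "\<dots> = of_nat (Suc N) + (\<Sum>n. emeasure P (?U n))"
      by (subst nn_integral_add) (auto simp: nn_integral_suminf P.emeasure_space_1)
    also have "(\<Sum>n. emeasure P (?U n)) \<le> (\<Sum>n. ennreal (\<Sum>k\<in>K. measure P (B n k)))"
    proof (intro suminf_le)
      fix n
      have "measure P (?U n) \<le> (\<Sum>k\<in>K. measure P (B n k))"
        using K B by (intro P.finite_measure_subadditive_finite) auto
      then show "emeasure P (?U n) \<le> ennreal (\<Sum>k\<in>K. measure P (B n k))"
        unfolding P.emeasure_eq_measure by (rule ennreal_leI)
    qed auto
    also have "\<dots> = ennreal (\<Sum>n. \<Sum>k\<in>K. measure P (B n k))"
      using sumK by (intro suminf_ennreal2) (auto intro: sum_nonneg)
    finally have "mean_time P T \<le> of_nat (Suc N) + ennreal (\<Sum>n. \<Sum>k\<in>K. measure P (B n k))"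
      by (simp add: add_left_mono)
    also have "\<dots> = ennreal (real N + C)"
      using nonneg by (simp add: C_def ennreal_of_nat_eq_real_of_nat ennreal_plus[symmetric] algebra_simps del: ennreal_plus)
    finally show "mean_time P T \<le> ennreal (real N + C)" .
  qed
qed

section \<open>Stopping of the joint procedure under a fixed signal\<close>

locale isolation_setting =
  fixes M :: "'b model"
    and J :: "'b path measure \<Rightarrow> 'b path measure \<Rightarrow> real"
    and d :: "'b design"
    and P :: "'b path measure"
  assumes model: "valid_model M"
    and ac: "mutually_ac M"
    and pos: "info_pos M J"
    and M: "cond_M M J"
    and CC: "cond_CC M J"
    and design: "valid_design M d"
    and nonempty: "H0 M \<noteq> {}" "\<And>e. e \<in> units M \<Longrightarrow> GPsi M e \<noteq> {}"
      "\<And>e. e \<in> units M \<Longrightarrow> HPsi M e \<noteq> {}"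
    and P: "P \<in> PPsi M - H0 M"
begin

lemma source_law_dists: "Q \<in> dists M \<Longrightarrow> source_law M Q"
  using model by (auto simp: valid_model_def source_law_def)

lemma families_subset: "H0 M \<subseteq> dists M" "HPsi M e \<subseteq> dists M" "GPsi M e \<subseteq> dists M"
  by (auto simp: H0_def HPsi_def GPsi_def PPsi_def)

lemma source_law_families:
  "Q \<in> H0 M \<Longrightarrow> source_law M Q" "Q \<in> HPsi M e \<Longrightarrow> source_law M Q" "Q \<in> GPsi M e \<Longrightarrow> source_law M Q"
  using families_subset source_law_dists by blast+

lemma source_law_P: "source_law M P"
  using P source_law_dists by (auto simp: PPsi_def)

lemma finite_families: "finite (H0 M)" "finite (HPsi M e)" "finite (GPsi M e)"
  using model finite_subset[OF families_subset(1)] finite_subset[OF families_subset(2)]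
    finite_subset[OF families_subset(3)]
  by (auto simp: valid_model_def)

lemma finite_units: "finite (units M)"
  using model by (auto simp: valid_model_def sources_def intro: finite_subset)

lemma act_subset: "act M Q \<subseteq> units M"
  by (auto simp: act_def)

lemma finite_act: "finite (act M P)"
  using act_subset finite_units by (rule finite_subset)

lemma act_nonempty: "act M P \<noteq> {}"
  using P by (auto simp: PPsi_def H0_def act_def)

lemma unit_subset: "e \<in> units M \<Longrightarrow> e \<subseteq> sources M"
  using model by (auto simp: valid_model_def)

lemma P_in_GPsi: "e \<in> act M P \<Longrightarrow> P \<in> GPsi M e"
  using P by (auto simp: GPsi_def)

lemma P_in_HPsi: "e \<notin> act M P \<Longrightarrow> P \<in> HPsi M e"
  using P by (auto simp: HPsi_def)

lemma act_H0: "Q \<in> H0 M \<Longrightarrow> act M Q = {}"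
  using model by (fastforce simp: H0_def act_def valid_model_def)

lemma H0_subset_PPsi: "{} \<in> psi M \<Longrightarrow> Q \<in> H0 M \<Longrightarrow> Q \<in> PPsi M"
  using act_H0[of Q] by (auto simp: H0_def PPsi_def)

lemma GPsi_not_H0: "Q \<in> GPsi M e \<Longrightarrow> Q \<notin> H0 M"
  using act_H0[of Q] by (auto simp: GPsi_def)

lemma design_subset:
  assumes "e \<in> units M"
  shows "e \<subseteq> det_sub d e" "det_sub d e \<subseteq> sources M" "e \<subseteq> iso_sub d e" "iso_sub d e \<subseteq> sources M"
  using assms design by (auto simp: valid_design_def)

lemma acD:
  assumes "e \<in> units M" "R \<in> GPsi M e \<union> H0 M" "Q \<in> HPsi M e \<union> H0 M" "e \<subseteq> s" "s \<subseteq> sources M" "1 \<le> n"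
  shows "absolutely_continuous (law_upto M s n R) (law_upto M s n Q)"
    "absolutely_continuous (law_upto M s n Q) (law_upto M s n R)"
proof -
  from ac have "\<forall>n\<ge>1. absolutely_continuous (law_upto M s n R) (law_upto M s n Q) \<and>
      absolutely_continuous (law_upto M s n Q) (law_upto M s n R)"
    unfolding mutually_ac_def Let_def law_upto_def using assms(1-5) by blast
  with assms(6) show "absolutely_continuous (law_upto M s n R) (law_upto M s n Q)"
    "absolutely_continuous (law_upto M s n Q) (law_upto M s n R)"
    by auto
qed

text \<open>
  \<open>P\<close> and \<open>Q\<close> belong to different hypotheses about the unit \<open>e\<close>. The standing conditions are formulated
  for a signal-carrying first law; since they hold in both directions, they are available
  for the ordered pair \<open>(P, Q)\<close> whichever of the two carries the signal.
\<close>

definition contrasted :: "nat set \<Rightarrow> 'b path measure \<Rightarrow> bool" where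
  "contrasted e Q \<longleftrightarrow> e \<in> units M \<and>
    (P \<in> GPsi M e \<and> Q \<in> HPsi M e \<union> H0 M \<or> P \<in> HPsi M e \<and> Q \<in> GPsi M e)"

lemma contrasted_act: "e \<in> act M P \<Longrightarrow> Q \<in> HPsi M e \<union> H0 M \<Longrightarrow> contrasted e Q"
  using act_subset P_in_GPsi by (auto simp: contrasted_def)

lemma contrasted_nonact: "e \<in> units M - act M P \<Longrightarrow> Q \<in> GPsi M e \<Longrightarrow> contrasted e Q"
  using P_in_HPsi by (auto simp: contrasted_def)

lemma contrastedD:
  assumes "contrasted e Q" "e \<subseteq> s" "s \<subseteq> sources M"
  shows "source_law M Q" "0 < J (law M s P) (law M s Q)"
    "max_upcrossing M J s P Q" "complete_conv M J s P Q"
proof -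
  have e: "e \<in> units M"
    and Q: "P \<in> GPsi M e \<and> Q \<in> HPsi M e \<union> H0 M \<or> P \<in> HPsi M e \<and> Q \<in> GPsi M e"
    using assms(1) by (auto simp: contrasted_def)
  show "source_law M Q" using Q by (auto intro: source_law_families)
  show "0 < J (law M s P) (law M s Q)"
    using pos e Q assms(2,3) unfolding info_pos_def by blast
  show "max_upcrossing M J s P Q"
    using M e Q assms(2,3) unfolding cond_M_def by blast
  show "complete_conv M J s P Q"
    using CC e Q assms(2,3) unfolding cond_CC_def by blast
qed

lemma contrasted_ac:
  assumes "contrasted e Q" "e \<subseteq> s" "s \<subseteq> sources M" "1 \<le> n" "R \<in> H0 M"
  shows "absolutely_continuous (law_upto M s n Q) (law_upto M s n P)"
    "absolutely_continuous (law_upto M s n R) (law_upto M s n Q)"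
    "absolutely_continuous (law_upto M s n R) (law_upto M s n P)"
  using assms(1,5) acD[OF _ _ _ assms(2-4)] unfolding contrasted_def by blast+

abbreviation P_leads :: "nat set \<Rightarrow> 'b path measure set \<Rightarrow> nat \<Rightarrow> real \<Rightarrow> 'b path \<Rightarrow> bool" where
  "P_leads s \<Q> n c \<omega> \<equiv> \<forall>Q\<in>\<Q>. c \<le> Z M s n (law M s P) (law M s Q) \<omega>"

text \<open>
  A lead over \<open>\<Q>\<close> is a statement about direct comparisons, whereas the statistics compare all laws with
  a common reference \<open>R\<close>. The two agree because the reference cancels.
\<close>

lemma P_leads_LR:
  assumes e: "e \<subseteq> s" "s \<subseteq> sources M" and n: "1 \<le> n"
    and \<Q>: "finite \<Q>" "\<And>Q. Q \<in> \<Q> \<Longrightarrow> contrasted e Q" and R: "R \<in> H0 M"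
  shows "AE \<omega> in P. \<forall>c>0. P_leads s \<Q> n c \<omega> \<longrightarrow> (\<forall>Q\<in>\<Q>.
      0 < LR M s n (law M s Q) (law M s R) \<omega> \<and>
      exp c * LR M s n (law M s Q) (law M s R) \<omega> \<le> LR M s n (law M s P) (law M s R) \<omega>)"
proof -
  have "AE \<omega> in P. \<forall>Q\<in>\<Q>. \<forall>c>0. c \<le> Z M s n (law M s P) (law M s Q) \<omega> \<longrightarrow>
      0 < LR M s n (law M s Q) (law M s R) \<omega> \<and>
      exp c * LR M s n (law M s Q) (law M s R) \<omega> \<le> LR M s n (law M s P) (law M s R) \<omega>"
    using \<Q> R
    by (intro AE_finite_allI LR_dominates source_law_P source_law_families(1)
        contrasted_ac[OF _ e n] contrastedD(1)[OF _ e] e(2)) auto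
  then show ?thesis
    by eventually_elim blast
qed

text \<open>
  \<open>P\<close> is among the laws in the numerator, and each law in the denominator is less likely by a
  factor of at least \<open>exp c\<close>.
\<close>

lemma Lam_det_ge:
  assumes e: "e \<in> act M P" and n: "1 \<le> n"
  shows "AE \<omega> in P. \<forall>c>0. P_leads (det_sub d e) (H0 M) n c \<omega> \<longrightarrow> exp c \<le> Lam_det M d e n \<omega>"
proof -
  let ?s = "det_sub d e"
  have eu: "e \<in> units M" using e act_subset by auto
  obtain R where R: "R \<in> H0 M" "det_ref d e = law M ?s R"
    using design eu by (auto simp: valid_design_def)
  have "AE \<omega> in P. \<forall>c>0. P_leads ?s (H0 M) n c \<omega> \<longrightarrow> (\<forall>Q\<in>H0 M.
      0 < LR M ?s n (law M ?s Q) (law M ?s R) \<omega> \<and>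
      exp c * LR M ?s n (law M ?s Q) (law M ?s R) \<omega> \<le> LR M ?s n (law M ?s P) (law M ?s R) \<omega>)"
    by (rule P_leads_LR[OF design_subset(1,2)[OF eu] n])
       (use contrasted_act[OF e] finite_families R(1) in auto)
  then show ?thesis
  proof (eventually_elim, intro allI impI)
    fix \<omega> and c :: real
    assume *: "\<forall>c>0. P_leads ?s (H0 M) n c \<omega> \<longrightarrow> (\<forall>Q\<in>H0 M.
        0 < LR M ?s n (law M ?s Q) (law M ?s R) \<omega> \<and>
        exp c * LR M ?s n (law M ?s Q) (law M ?s R) \<omega> \<le> LR M ?s n (law M ?s P) (law M ?s R) \<omega>)"
      and c: "0 < c" "P_leads ?s (H0 M) n c \<omega>"
    note *[rule_format, OF c(1), OF c(2)[rule_format]]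
    then show "exp c \<le> Lam_det M d e n \<omega>"
      unfolding Lam_det_def R(2) using P_in_GPsi[OF e] nonempty
      by (intro Max_ratio_ge[where x = "law M ?s P"] finite_imageI finite_families) auto
  qed
qed

lemma Lam_iso_ge:
  assumes e: "e \<in> act M P" and n: "1 \<le> n"
  shows "AE \<omega> in P. \<forall>c>0. P_leads (iso_sub d e) (HPsi M e) n c \<omega> \<longrightarrow> exp c \<le> Lam_iso M d e n \<omega>"
proof -
  let ?s = "iso_sub d e"
  have eu: "e \<in> units M" using e act_subset by auto
  obtain R where R: "R \<in> H0 M" "iso_ref d e = law M ?s R"
    using design eu by (auto simp: valid_design_def)
  have "AE \<omega> in P. \<forall>c>0. P_leads ?s (HPsi M e) n c \<omega> \<longrightarrow> (\<forall>Q\<in>HPsi M e.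
      0 < LR M ?s n (law M ?s Q) (law M ?s R) \<omega> \<and>
      exp c * LR M ?s n (law M ?s Q) (law M ?s R) \<omega> \<le> LR M ?s n (law M ?s P) (law M ?s R) \<omega>)"
    by (rule P_leads_LR[OF design_subset(3,4)[OF eu] n])
       (use contrasted_act[OF e] finite_families R(1) in auto)
  then show ?thesis
  proof (eventually_elim, intro allI impI)
    fix \<omega> and c :: real
    assume *: "\<forall>c>0. P_leads ?s (HPsi M e) n c \<omega> \<longrightarrow> (\<forall>Q\<in>HPsi M e.
        0 < LR M ?s n (law M ?s Q) (law M ?s R) \<omega> \<and>
        exp c * LR M ?s n (law M ?s Q) (law M ?s R) \<omega> \<le> LR M ?s n (law M ?s P) (law M ?s R) \<omega>)"
      and c: "0 < c" "P_leads ?s (HPsi M e) n c \<omega>"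
    note *[rule_format, OF c(1), OF c(2)[rule_format]]
    then show "exp c \<le> Lam_iso M d e n \<omega>"
      unfolding Lam_iso_def R(2) using P_in_GPsi[OF e] nonempty(3)[OF eu]
      by (intro Max_ratio_ge[where x = "law M ?s P"] finite_imageI finite_families) auto
  qed
qed

text \<open>
  Here \<open>P\<close> occurs in the denominator instead.
\<close>

lemma Lam_iso_le:
  assumes e: "e \<in> units M - act M P" and n: "1 \<le> n"
  shows "AE \<omega> in P. \<forall>c>0. P_leads (iso_sub d e) (GPsi M e) n c \<omega> \<longrightarrow> Lam_iso M d e n \<omega> \<le> 1 / exp c"
proof -
  let ?s = "iso_sub d e"
  have eu: "e \<in> units M" "e \<notin> act M P" using e by auto
  obtain R where R: "R \<in> H0 M" "iso_ref d e = law M ?s R"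
    using design eu by (auto simp: valid_design_def)
  have "AE \<omega> in P. \<forall>c>0. P_leads ?s (GPsi M e) n c \<omega> \<longrightarrow> (\<forall>Q\<in>GPsi M e.
      0 < LR M ?s n (law M ?s Q) (law M ?s R) \<omega> \<and>
      exp c * LR M ?s n (law M ?s Q) (law M ?s R) \<omega> \<le> LR M ?s n (law M ?s P) (law M ?s R) \<omega>)"
    by (rule P_leads_LR[OF design_subset(3,4)[OF eu(1)] n])
       (use contrasted_nonact[OF e] finite_families R(1) in auto)
  then show ?thesis
  proof (eventually_elim, intro allI impI)
    fix \<omega> and c :: real
    assume *: "\<forall>c>0. P_leads ?s (GPsi M e) n c \<omega> \<longrightarrow> (\<forall>Q\<in>GPsi M e.
        0 < LR M ?s n (law M ?s Q) (law M ?s R) \<omega> \<and>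
        exp c * LR M ?s n (law M ?s Q) (law M ?s R) \<omega> \<le> LR M ?s n (law M ?s P) (law M ?s R) \<omega>)"
      and c: "0 < c" "P_leads ?s (GPsi M e) n c \<omega>"
    note *[rule_format, OF c(1), OF c(2)[rule_format]]
    then show "Lam_iso M d e n \<omega> \<le> 1 / exp c"
      unfolding Lam_iso_def R(2) using P_in_HPsi[OF eu(2)] nonempty(2)[OF eu(1)]
      by (intro Max_ratio_le[where x = "law M ?s P"] finite_imageI finite_families) auto
  qed
qed

lemma info_le: "finite \<Q> \<Longrightarrow> Q \<in> \<Q> \<Longrightarrow> info M J R \<Q> s \<le> J (law M s R) (law M s Q)"
  unfolding info_def by (intro Min_le) auto

lemma info_attained:
  assumes "finite \<Q>" "\<Q> \<noteq> {}"
  obtains Q where "Q \<in> \<Q>" "info M J R \<Q> s = J (law M s R) (law M s Q)"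
proof -
  have "info M J R \<Q> s \<in> (\<lambda>Q. J (law M s R) (law M s Q)) ` \<Q>"
    unfolding info_def using assms by (intro Min_in) auto
  then show ?thesis using that by auto
qed

lemma info_contrasted_pos:
  assumes "finite \<Q>" "\<Q> \<noteq> {}" "\<And>Q. Q \<in> \<Q> \<Longrightarrow> contrasted e Q" "e \<subseteq> s" "s \<subseteq> sources M"
  shows "0 < info M J P \<Q> s"
  by (rule info_attained[OF assms(1,2), of P s]) (use contrastedD(2)[OF assms(3-5)] in auto)

lemma info_pos_act:
  assumes e: "e \<in> act M P" "e \<subseteq> s" "s \<subseteq> sources M"
  shows "0 < info M J P (H0 M) s" "0 < info M J P (HPsi M e) s"
proof -
  have eu: "e \<in> units M" using e act_subset by auto
  show "0 < info M J P (H0 M) s" "0 < info M J P (HPsi M e) s"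
    using contrasted_act[OF e(1)] nonempty eu
    by (auto intro!: info_contrasted_pos[OF _ _ _ e(2,3)] finite_families)
qed

lemma info_pos_nonact:
  assumes "e \<in> units M - act M P" "e \<subseteq> s" "s \<subseteq> sources M"
  shows "0 < info M J P (GPsi M e) s"
  using contrasted_nonact[OF assms(1)] nonempty(2) assms
  by (auto intro!: info_contrasted_pos[OF _ _ _ assms(2,3)] finite_families)

text \<open>
  Once all isolation statistics have passed their thresholds on the correct side of 1, the isolated
  set is the true one, which belongs to \<open>\<Psi>\<close> and is nonempty. A single unit suffices for detection.
\<close>

lemma T_star_le:
  assumes n: "1 \<le> n"
    and D: "u \<in> act M P" "D u \<le> Lam_det M d u n \<omega>"
    and act: "\<And>e. e \<in> act M P \<Longrightarrow> B e \<le> Lam_iso M d e n \<omega> \<and> 1 < Lam_iso M d e n \<omega>"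
    and nonact: "\<And>e. e \<in> units M - act M P \<Longrightarrow> Lam_iso M d e n \<omega> \<le> 1 / A e \<and> Lam_iso M d e n \<omega> \<le> 1"
  shows "T_star M d A B C D \<omega> \<le> enat n"
proof -
  have "D_iso M d n \<omega> = act M P"
    using act nonact act_subset[of P] by (force simp: D_iso_def)
  moreover have "act M P \<in> psi M - {{}}"
    using P act_nonempty by (auto simp: PPsi_def)
  moreover have "Lam_iso M d e n \<omega> \<notin> {1 / A e <..< B e}" if "e \<in> units M" for e
    using act[of e] nonact[of e] that by (cases "e \<in> act M P") auto
  moreover have "\<exists>e\<in>units M. Lam_det M d e n \<omega> \<ge> D e"
    using D act_subset[of P] by auto
  ultimately have "T_joint M d A B D \<omega> \<le> enat n"
    unfolding T_joint_def using n by (intro Inf_lower) auto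
  then show ?thesis
    by (simp add: T_star_def min.coboundedI2)
qed

text \<open>
  Up to a constant, the mean is the time \<open>r\<close> at which the lines with slopes \<open>\<kappa>\<close> times the information
  numbers have crossed all logarithmic thresholds. The constant does not depend on the thresholds, which may
  therefore tend to infinity at arbitrary relative rates. Stopping at \<open>T_0\<close> can only shorten the procedure.
\<close>

lemma mean_time_T_star_le:
  assumes e0: "e0 \<in> act M P" and \<kappa>: "0 < \<kappa>" "\<kappa> < 1"
  obtains K where "0 \<le> K" and
    "\<And>A B C D r. (\<And>e. e \<in> units M \<Longrightarrow> 0 < A e \<and> 0 < B e) \<Longrightarrow> 0 < D e0 \<Longrightarrow> 0 \<le> r \<Longrightarrow>
      ln (D e0) \<le> \<kappa> * info M J P (H0 M) (det_sub d e0) * r \<Longrightarrow>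
      (\<And>e. e \<in> act M P \<Longrightarrow> ln (B e) \<le> \<kappa> * info M J P (HPsi M e) (iso_sub d e) * r) \<Longrightarrow>
      (\<And>e. e \<in> units M - act M P \<Longrightarrow> ln (A e) \<le> \<kappa> * info M J P (GPsi M e) (iso_sub d e) * r) \<Longrightarrow>
      mean_time P (T_star M d A B C D) \<le> ennreal (r + K)"
proof -
  let ?d = "\<lambda>e. \<kappa> * info M J P (H0 M) (det_sub d e)"
  let ?h = "\<lambda>e. \<kappa> * info M J P (HPsi M e) (iso_sub d e)"
  let ?g = "\<lambda>e. \<kappa> * info M J P (GPsi M e) (iso_sub d e)"
  \<comment> \<open>Detection is required of the single unit \<open>e0\<close>, isolation of all units. All laws of a family share the slope of its least information number.\<close>
  define I where "I = (\<lambda>Q. (det_sub d e0, Q, ?d e0)) ` H0 M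
    \<union> (\<Union>e\<in>act M P. (\<lambda>Q. (iso_sub d e, Q, ?h e)) ` HPsi M e)
    \<union> (\<Union>e\<in>units M - act M P. (\<lambda>Q. (iso_sub d e, Q, ?g e)) ` GPsi M e)"
  have "finite I"
    unfolding I_def using finite_families finite_units finite_act by auto
  have e0u: "e0 \<in> units M" using e0 act_subset by auto
  have pos_d: "0 < ?d e0"
    using info_pos_act(1)[OF e0 design_subset(1,2)[OF e0u]] \<kappa> by simp
  have pos_h: "0 < ?h e" if "e \<in> act M P" for e
    using info_pos_act(2)[OF that design_subset(3,4)] that act_subset \<kappa> by (auto intro!: mult_pos_pos)
  have pos_g: "0 < ?g e" if "e \<in> units M - act M P" for e
    using info_pos_nonact[OF that design_subset(3,4)] that \<kappa> by (auto intro!: mult_pos_pos)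
  have shrink: "\<kappa> * i < j" if "0 < \<kappa> * i" "i \<le> j" for i j :: real
    using that \<kappa> by (smt (verit) mult_less_cancel_right2 zero_less_mult_pos)
  have conv: "s \<subseteq> sources M \<and> complete_conv M J s P Q \<and> \<rho> < J (law M s P) (law M s Q)"
    if "(s, Q, \<rho>) \<in> I" for s Q \<rho>
  proof -
    consider "s = det_sub d e0" "Q \<in> H0 M" "\<rho> = ?d e0"
      | e where "e \<in> act M P" "s = iso_sub d e" "Q \<in> HPsi M e" "\<rho> = ?h e"
      | e where "e \<in> units M - act M P" "s = iso_sub d e" "Q \<in> GPsi M e" "\<rho> = ?g e"
      using \<open>(s, Q, \<rho>) \<in> I\<close> unfolding I_def by (elim UnE UN_E imageE) auto
    then show ?thesis
    proof cases
      case 1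
      then show ?thesis
        using design_subset(2)[OF e0u] shrink[OF pos_d info_le[OF finite_families(1)]]
          contrastedD(4)[OF contrasted_act[OF e0] design_subset(1,2)[OF e0u]] by auto
    next
      case 2
      then have eu: "e \<in> units M" using act_subset by auto
      show ?thesis
        using 2 design_subset(4)[OF eu] shrink[OF pos_h info_le[OF finite_families(2)]]
          contrastedD(4)[OF contrasted_act[OF 2(1)] design_subset(3,4)[OF eu]] by auto
    next
      case 3
      then have eu: "e \<in> units M" by auto
      show ?thesis
        using 3 design_subset(4)[OF eu] shrink[OF pos_g info_le[OF finite_families(3)]]
          contrastedD(4)[OF contrasted_nonact[OF 3(1)] design_subset(3,4)[OF eu]] by auto
    qed
  qed
  obtain K where K: "0 \<le> K" and bound:
    "\<And>T N. (AE \<omega> in P. \<forall>n\<ge>N. 1 \<le> n \<longrightarrow>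
         (\<forall>(s, Q, \<rho>)\<in>I. real n * \<rho> \<le> Z M s n (law M s P) (law M s Q) \<omega>) \<longrightarrow> T \<omega> \<le> enat n) \<Longrightarrow>
       mean_time P T \<le> ennreal (real N + K)"
    by (rule mean_time_upper_bound[OF source_law_P \<open>finite I\<close> conv]) (assumption | rule that)+
  show ?thesis
  proof (rule that[of "K + 1"])
    show "0 \<le> K + 1" using K by simp
    fix A B C D :: "nat set \<Rightarrow> real" and r :: real
    assume AB: "\<And>e. e \<in> units M \<Longrightarrow> 0 < A e \<and> 0 < B e" and D0: "0 < D e0" and r: "0 \<le> r"
      and D: "ln (D e0) \<le> ?d e0 * r"
      and B: "\<And>e. e \<in> act M P \<Longrightarrow> ln (B e) \<le> ?h e * r"
      and A: "\<And>e. e \<in> units M - act M P \<Longrightarrow> ln (A e) \<le> ?g e * r"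
    \<comment> \<open>Rounding \<open>r\<close> up costs at most 1, which is added to the constant.\<close>
    let ?N = "nat \<lceil>r\<rceil>"
    have thr: "t \<le> exp (real n * \<rho>)" if "?N \<le> n" "0 < t" "0 < \<rho>" "ln t \<le> \<rho> * r" for n t \<rho>
    proof -
      have "r \<le> real n" using that(1) by linarith
      then have "\<rho> * r \<le> real n * \<rho>" using that(3) by (simp add: mult.commute)
      with that(4) have "ln t \<le> real n * \<rho>" by simp
      with that(2) show ?thesis by (metis exp_le_cancel_iff exp_ln)
    qed
    have "AE \<omega> in P. \<forall>n. 1 \<le> n \<longrightarrow>
       (\<forall>c>0. P_leads (det_sub d e0) (H0 M) n c \<omega> \<longrightarrow> exp c \<le> Lam_det M d e0 n \<omega>) \<and>
       (\<forall>e\<in>act M P. \<forall>c>0. P_leads (iso_sub d e) (HPsi M e) n c \<omega> \<longrightarrow> exp c \<le> Lam_iso M d e n \<omega>) \<and>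
       (\<forall>e\<in>units M - act M P. \<forall>c>0. P_leads (iso_sub d e) (GPsi M e) n c \<omega> \<longrightarrow>
          Lam_iso M d e n \<omega> \<le> 1 / exp c)"
      unfolding AE_all_countable using finite_units finite_act
      by (intro allI AE_impI AE_conjI AE_finite_allI Lam_det_ge[OF e0] Lam_iso_ge Lam_iso_le) auto
    then have "AE \<omega> in P. \<forall>n\<ge>?N. 1 \<le> n \<longrightarrow>
         (\<forall>(s, Q, \<rho>)\<in>I. real n * \<rho> \<le> Z M s n (law M s P) (law M s Q) \<omega>) \<longrightarrow> T_star M d A B C D \<omega> \<le> enat n"
    proof (eventually_elim, intro allI impI)
      fix \<omega> n
      assume *: "\<forall>n. 1 \<le> n \<longrightarrow>
       (\<forall>c>0. P_leads (det_sub d e0) (H0 M) n c \<omega> \<longrightarrow> exp c \<le> Lam_det M d e0 n \<omega>) \<and>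
       (\<forall>e\<in>act M P. \<forall>c>0. P_leads (iso_sub d e) (HPsi M e) n c \<omega> \<longrightarrow> exp c \<le> Lam_iso M d e n \<omega>) \<and>
       (\<forall>e\<in>units M - act M P. \<forall>c>0. P_leads (iso_sub d e) (GPsi M e) n c \<omega> \<longrightarrow>
          Lam_iso M d e n \<omega> \<le> 1 / exp c)"
        and n: "?N \<le> n" "1 \<le> n"
        and Zs: "\<forall>(s, Q, \<rho>)\<in>I. real n * \<rho> \<le> Z M s n (law M s P) (law M s Q) \<omega>"
      have large: "0 < real n * \<rho>" if "0 < \<rho>" for \<rho>
        using n(2) that by simp
      have "P_leads (det_sub d e0) (H0 M) n (real n * ?d e0) \<omega>"
        using Zs unfolding I_def ball_Un by auto
      then have "exp (real n * ?d e0) \<le> Lam_det M d e0 n \<omega>"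
        using * n(2) large[OF pos_d] by blast
      then have 1: "D e0 \<le> Lam_det M d e0 n \<omega>"
        using thr[OF n(1) D0 pos_d D] by linarith
      have 2: "B e \<le> Lam_iso M d e n \<omega> \<and> 1 < Lam_iso M d e n \<omega>" if "e \<in> act M P" for e
      proof -
        have "P_leads (iso_sub d e) (HPsi M e) n (real n * ?h e) \<omega>"
          using Zs that unfolding I_def ball_Un by auto
        then have "exp (real n * ?h e) \<le> Lam_iso M d e n \<omega>"
          using * n(2) that large[OF pos_h[OF that]] by blast
        moreover have "0 < B e" using AB that act_subset by auto
        note thr[OF n(1) this pos_h[OF that] B[OF that]]
        moreover have "1 < exp (real n * ?h e)"
          using large[OF pos_h[OF that]] by simp
        ultimately show ?thesis by linarith
      qed
      have 3: "Lam_iso M d e n \<omega> \<le> 1 / A e \<and> Lam_iso M d e n \<omega> \<le> 1" if "e \<in> units M - act M P" for e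
      proof -
        have "P_leads (iso_sub d e) (GPsi M e) n (real n * ?g e) \<omega>"
          using Zs that unfolding I_def ball_Un by auto
        then have "Lam_iso M d e n \<omega> \<le> 1 / exp (real n * ?g e)"
          using * n(2) that large[OF pos_g[OF that]] by blast
        moreover have A0: "0 < A e" using AB that by auto
        have "1 / exp (real n * ?g e) \<le> 1 / A e"
          using thr[OF n(1) A0 pos_g[OF that] A[OF that]] A0 by (intro divide_left_mono) auto
        moreover have "1 / exp (real n * ?g e) \<le> 1"
          using large[OF pos_g[OF that]] by simp
        ultimately show ?thesis by linarith
      qed
      show "T_star M d A B C D \<omega> \<le> enat n"
        by (rule T_star_le[where u = e0]) (use n(2) e0 1 2 3 in auto)
    qed
    then have "mean_time P (T_star M d A B C D) \<le> ennreal (real ?N + K)"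
      by (rule bound)
    also have "\<dots> \<le> ennreal (r + (K + 1))"
      using r by (intro ennreal_leI) linarith
    finally show "mean_time P (T_star M d A B C D) \<le> ennreal (r + (K + 1))" .
  qed
qed

end

section \<open>First-order asymptotics\<close>

text \<open>
  The upper bound makes \<open>f\<close> eventually finite, so that the ratio can be treated in the reals.
\<close>

lemma ennreal_equiv_sandwich:
  fixes f :: "'x \<Rightarrow> ennreal" and r :: "'x \<Rightarrow> real"
  assumes lower: "\<And>\<epsilon>. 0 < \<epsilon> \<Longrightarrow> \<epsilon> < 1 \<Longrightarrow> eventually (\<lambda>x. ennreal ((1 - \<epsilon>) * r x) \<le> f x) F"
    and upper: "\<And>\<epsilon>. 0 < \<epsilon> \<Longrightarrow> \<epsilon> < 1 \<Longrightarrow> eventually (\<lambda>x. f x \<le> ennreal ((1 + \<epsilon>) * r x)) F"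
    and r: "eventually (\<lambda>x. 0 < r x) F"
  shows "ennreal_equiv f F (\<lambda>x. ennreal (r x))" "ennreal_equiv (\<lambda>x. ennreal (r x)) F f"
proof -
  define h where "h x = enn2real (f x)" for x
  \<comment> \<open>The value 1/2 is immaterial: any upper bound by a real number shows finiteness.\<close>
  have f_eq: "eventually (\<lambda>x. f x = ennreal (h x)) F"
    using upper[of "1/2"] by (auto elim!: eventually_mono simp: h_def top_unique less_top intro!: ennreal_enn2real[symmetric] intro: le_less_trans)
  have near: "eventually (\<lambda>x. \<bar>h x / r x - 1\<bar> \<le> \<epsilon>) F" if "0 < \<epsilon>" "\<epsilon> < 1" for \<epsilon>
    using lower[OF that] upper[OF that] r f_eq
  proof eventually_elim
    case (elim x)
    have "0 \<le> h x" by (simp add: h_def)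
    have "0 \<le> (1 + \<epsilon>) * r x" using elim(3) that by simp
    with elim \<open>0 \<le> h x\<close> have "(1 - \<epsilon>) * r x \<le> h x" "h x \<le> (1 + \<epsilon>) * r x"
      by (auto simp: ennreal_le_iff)
    then have "1 - \<epsilon> \<le> h x / r x" "h x / r x \<le> 1 + \<epsilon>"
      using elim(3) by (simp_all add: pos_le_divide_eq pos_divide_le_eq)
    then show ?case by (simp add: abs_le_iff)
  qed
  have lim: "((\<lambda>x. h x / r x) \<longlongrightarrow> 1) F"
  proof (rule tendstoI)
    fix e :: real assume "0 < e"
    \<comment> \<open>The sandwich is available for accuracies below 1 only.\<close>
    define \<epsilon> where "\<epsilon> = min (e / 2) (1 / 2)"
    have \<epsilon>: "0 < \<epsilon>" "\<epsilon> < 1" "\<epsilon> < e" using \<open>0 < e\<close> by (auto simp: \<epsilon>_def)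
    show "eventually (\<lambda>x. dist (h x / r x) 1 < e) F"
      using near[OF \<epsilon>(1,2)] by eventually_elim (use \<epsilon>(3) in \<open>simp add: dist_real_def\<close>)
  qed
  have hpos: "eventually (\<lambda>x. 0 < h x) F"
  proof -
    have "eventually (\<lambda>x. 0 < h x / r x) F"
      by (rule order_tendstoD(1)[OF lim]) simp
    with r show ?thesis
      by eventually_elim (auto simp: zero_less_divide_iff)
  qed
  have "((\<lambda>x. ennreal (h x / r x)) \<longlongrightarrow> ennreal 1) F"
    using lim by (rule tendsto_ennrealI)
  moreover have "eventually (\<lambda>x. ennreal (h x / r x) = f x / ennreal (r x)) F"
    using f_eq r hpos by eventually_elim (simp add: divide_ennreal)
  ultimately show "ennreal_equiv f F (\<lambda>x. ennreal (r x))"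
    unfolding ennreal_equiv_def by (auto intro: Lim_transform_eventually)
  have "((\<lambda>x. inverse (h x / r x)) \<longlongrightarrow> inverse 1) F"
    using lim by (rule tendsto_inverse) simp
  then have "((\<lambda>x. ennreal (r x / h x)) \<longlongrightarrow> ennreal 1) F"
    by (intro tendsto_ennrealI) simp
  moreover have "eventually (\<lambda>x. ennreal (r x / h x) = ennreal (r x) / f x) F"
    using f_eq r hpos by eventually_elim (simp add: divide_ennreal)
  ultimately show "ennreal_equiv (\<lambda>x. ennreal (r x)) F f"
    unfolding ennreal_equiv_def by (auto intro: Lim_transform_eventually)
qed

lemma asymp_equiv_eventually_le:
  fixes f g :: "'x \<Rightarrow> real"
  assumes "f \<sim>[F] g" "eventually (\<lambda>x. 0 < g x) F" "1 < q"
  shows "eventually (\<lambda>x. f x \<le> q * g x) F"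
proof -
  have "eventually (\<lambda>x. (if f x = 0 \<and> g x = 0 then 1 else f x / g x) < q) F"
    using assms(1,3) unfolding asymp_equiv_def by (rule order_tendstoD(2))
  with assms(2) show ?thesis
    by eventually_elim (auto simp: divide_less_eq less_imp_le)
qed

lemma abs_ln_at_top: "filterlim (\<lambda>x::real. \<bar>ln x\<bar>) at_top (at_right 0)"
proof (rule filterlim_at_top_mono)
  show "filterlim (\<lambda>x::real. - ln x) at_top (at_right 0)"
    using ln_at_0 by (simp add: filterlim_uminus_at_top)
qed (auto intro!: always_eventually)

lemma eventually_level:
  fixes \<kappa> :: "'x \<Rightarrow> real"
  assumes "filterlim \<kappa> (at_right 0) F"
  shows "eventually (\<lambda>x. 0 < \<kappa> x \<and> \<kappa> x < 1) F"
proof -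
  have "eventually (\<lambda>y::real. 0 < y \<and> y < 1) (at_right 0)"
    by (intro eventually_at_rightI[of 0 1]) auto
  from eventually_compose_filterlim[OF this assms] show ?thesis by simp
qed

context isolation_setting
begin

lemma eventually_lower_bound:
  assumes Q: "contrasted e Q"
    and \<epsilon>: "0 < \<epsilon>" "\<epsilon> < 1"
    and \<kappa>: "filterlim \<kappa> (at_right 0) F" and \<mu>: "(\<mu> \<longlongrightarrow> 0) F"
  shows "eventually (\<lambda>x. \<forall>T D S. is_test M T D \<longrightarrow>
      measure Q {\<omega> \<in> space Q. D \<omega> \<in> S} \<le> \<kappa> x \<longrightarrow> measure P {\<omega> \<in> space P. D \<omega> \<notin> S} \<le> \<mu> x \<longrightarrow>
      ennreal ((1 - \<epsilon>) * (\<bar>ln (\<kappa> x)\<bar> / J (law M (sources M) P) (law M (sources M) Q))) \<le> mean_time P T) F"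
proof -
  have s: "e \<subseteq> sources M" "sources M \<subseteq> sources M"
    using Q unit_subset by (auto simp: contrasted_def)
  obtain R where R: "R \<in> H0 M" using nonempty(1) by auto
  obtain L \<eta> where "0 < \<eta>" and bound:
    "\<And>T D S \<kappa>. is_test M T D \<Longrightarrow> 0 < \<kappa> \<Longrightarrow> \<kappa> < 1 \<Longrightarrow> L \<le> \<bar>ln \<kappa>\<bar> \<Longrightarrow>
       measure Q {\<omega> \<in> space Q. D \<omega> \<in> S} \<le> \<kappa> \<Longrightarrow> measure P {\<omega> \<in> space P. D \<omega> \<notin> S} \<le> \<eta> \<Longrightarrow>
       ennreal ((1 - \<epsilon>) * (\<bar>ln \<kappa>\<bar> / J (law M (sources M) P) (law M (sources M) Q))) \<le> mean_time P T"
    by (rule mean_time_lower_bound[OF source_law_P contrastedD(1)[OF Q s]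
          contrasted_ac(1)[OF Q s _ R] refl contrastedD(2,3)[OF Q s] \<epsilon>]) (assumption | rule that)+
  have "eventually (\<lambda>x. L \<le> \<bar>ln (\<kappa> x)\<bar>) F"
    using filterlim_compose[OF abs_ln_at_top \<kappa>] unfolding filterlim_at_top by blast
  moreover have "eventually (\<lambda>x. 0 < \<kappa> x \<and> \<kappa> x < 1) F"
    using \<kappa> by (rule eventually_level)
  moreover have "eventually (\<lambda>x. \<mu> x < \<eta>) F"
    using \<mu> \<open>0 < \<eta>\<close> by (rule order_tendstoD(2))
  ultimately show ?thesis
  proof eventually_elim
    case (elim x)
    show ?case
      by (intro allI impI bound) (use elim in auto)
  qed
qed

text \<open>
  In the application \<open>a\<close>, \<open>g\<close>, \<open>l\<close> are the absolute logarithms of the levels and \<open>r\<close> is the first-order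
  rate. Replacing log-thresholds by log-levels costs a factor \<open>q\<close>, and replacing information numbers by
  slopes a second one; \<open>q * q\<close> stays below \<open>1 + \<epsilon>\<close>, and the rest absorbs the constant.
\<close>

lemma eventually_T_star_le:
  fixes A B C D :: "'x \<Rightarrow> nat set \<Rightarrow> real" and a g l r :: "'x \<Rightarrow> real"
  assumes e0: "e0 \<in> act M P"
    and thr: "\<And>e. e \<in> units M \<Longrightarrow> eventually (\<lambda>x. 0 < A x e \<and> 0 < B x e \<and> 0 < D x e) F"
    and lev: "eventually (\<lambda>x. 0 < a x \<and> 0 < g x \<and> 0 < l x) F"
    and asymp: "\<And>e. e \<in> units M \<Longrightarrow> (\<lambda>x. ln (A x e)) \<sim>[F] l"
      "\<And>e. e \<in> units M \<Longrightarrow> (\<lambda>x. ln (B x e)) \<sim>[F] g"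
      "\<And>e. e \<in> units M \<Longrightarrow> (\<lambda>x. ln (D x e)) \<sim>[F] a"
    and r: "filterlim r at_top F"
    and rate: "eventually (\<lambda>x. a x \<le> info M J P (H0 M) (det_sub d e0) * r x) F"
      "\<And>e. e \<in> act M P \<Longrightarrow> eventually (\<lambda>x. g x \<le> info M J P (HPsi M e) (iso_sub d e) * r x) F"
      "\<And>e. e \<in> units M - act M P \<Longrightarrow> eventually (\<lambda>x. l x \<le> info M J P (GPsi M e) (iso_sub d e) * r x) F"
    and \<epsilon>: "0 < \<epsilon>" "\<epsilon> < 1"
  shows "eventually (\<lambda>x. mean_time P (T_star M d (A x) (B x) (C x) (D x)) \<le> ennreal ((1 + \<epsilon>) * r x)) F"
proof -
  define q where "q = 1 + \<epsilon> / 4"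
  have q: "1 < q" "0 < 1 / q" "1 / q < 1" using \<epsilon> by (auto simp: q_def)
  have e0u: "e0 \<in> units M" using e0 act_subset by auto
  from mean_time_T_star_le[OF e0 q(2,3)] obtain K where K: "0 \<le> K" and bound:
    "\<And>A B C D r. (\<And>e. e \<in> units M \<Longrightarrow> 0 < A e \<and> 0 < B e) \<Longrightarrow> 0 < D e0 \<Longrightarrow> 0 \<le> r \<Longrightarrow>
      ln (D e0) \<le> 1 / q * info M J P (H0 M) (det_sub d e0) * r \<Longrightarrow>
      (\<And>e. e \<in> act M P \<Longrightarrow> ln (B e) \<le> 1 / q * info M J P (HPsi M e) (iso_sub d e) * r) \<Longrightarrow>
      (\<And>e. e \<in> units M - act M P \<Longrightarrow> ln (A e) \<le> 1 / q * info M J P (GPsi M e) (iso_sub d e) * r) \<Longrightarrow>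
      mean_time P (T_star M d A B C D) \<le> ennreal (r + K)"
    by metis
  have step: "y \<le> 1 / q * i * (q * q * t)" if "y \<le> q * m" "m \<le> i * t" for y m i t :: real
  proof -
    have "q * m \<le> q * (i * t)" using that(2) q by (intro mult_left_mono) auto
    also have "\<dots> = 1 / q * i * (q * q * t)" using q by simp
    finally show ?thesis using that(1) by linarith
  qed
  have pos: "eventually (\<lambda>x. 0 < a x) F" "eventually (\<lambda>x. 0 < g x) F" "eventually (\<lambda>x. 0 < l x) F"
    using lev by (auto elim: eventually_mono)
  have "eventually (\<lambda>x. ln (D x e0) \<le> 1 / q * info M J P (H0 M) (det_sub d e0) * (q * q * r x)) F"
    using asymp_equiv_eventually_le[OF asymp(3)[OF e0u] pos(1) q(1)] rate(1)
    by eventually_elim (rule step)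
  moreover have "eventually (\<lambda>x. \<forall>e\<in>act M P. ln (B x e) \<le> 1 / q * info M J P (HPsi M e) (iso_sub d e) * (q * q * r x)) F"
  proof (intro eventually_ball_finite finite_act ballI)
    fix e assume e: "e \<in> act M P"
    then have eu: "e \<in> units M" using act_subset by auto
    show "eventually (\<lambda>x. ln (B x e) \<le> 1 / q * info M J P (HPsi M e) (iso_sub d e) * (q * q * r x)) F"
      using asymp_equiv_eventually_le[OF asymp(2)[OF eu] pos(2) q(1)] rate(2)[OF e]
      by eventually_elim (rule step)
  qed
  moreover have "eventually (\<lambda>x. \<forall>e\<in>units M - act M P. ln (A x e) \<le> 1 / q * info M J P (GPsi M e) (iso_sub d e) * (q * q * r x)) F"
  proof (intro eventually_ball_finite ballI)
    show "finite (units M - act M P)" using finite_units by simp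
    fix e assume e: "e \<in> units M - act M P"
    then have eu: "e \<in> units M" by auto
    show "eventually (\<lambda>x. ln (A x e) \<le> 1 / q * info M J P (GPsi M e) (iso_sub d e) * (q * q * r x)) F"
      using asymp_equiv_eventually_le[OF asymp(1)[OF eu] pos(3) q(1)] rate(3)[OF e]
      by eventually_elim (rule step)
  qed
  moreover have "eventually (\<lambda>x. \<forall>e\<in>units M. 0 < A x e \<and> 0 < B x e \<and> 0 < D x e) F"
    using thr finite_units by (intro eventually_ball_finite) auto
  moreover have "eventually (\<lambda>x. max 0 (4 * K / \<epsilon>) \<le> r x) F"
    using r unfolding filterlim_at_top by blast
  ultimately show ?thesis
  proof eventually_elim
    case (elim x)
    then have rx: "0 \<le> r x" "4 * K / \<epsilon> \<le> r x" by auto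
    have "mean_time P (T_star M d (A x) (B x) (C x) (D x)) \<le> ennreal (q * q * r x + K)"
      using elim e0u rx q(1) by (intro bound) auto
    also have "q * q * r x + K \<le> (1 + \<epsilon>) * r x"
    proof -
      have "K \<le> \<epsilon> / 4 * r x" using rx(2) \<epsilon> by (simp add: field_simps)
      moreover have "q * q \<le> 1 + 3 * \<epsilon> / 4"
      proof -
        have "\<epsilon> * \<epsilon> \<le> \<epsilon>" using \<epsilon> by (simp add: mult_le_cancel_left1)
        moreover have "q * q = 1 + \<epsilon> / 2 + \<epsilon> * \<epsilon> / 16" by (simp add: q_def algebra_simps)
        ultimately show ?thesis using \<epsilon> by linarith
      qed
      then have "q * q * r x \<le> (1 + 3 * \<epsilon> / 4) * r x"
        using rx(1) by (rule mult_right_mono)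
      ultimately show ?thesis by (simp add: algebra_simps)
    qed
    finally show ?case by (simp add: ennreal_leI)
  qed
qed

end

section \<open>Lower bounds in the two test classes\<close>

lemma level_tendsto_0:
  fixes \<kappa> :: "'x \<Rightarrow> real"
  shows "filterlim \<kappa> (at_right 0) F \<Longrightarrow> (\<kappa> \<longlongrightarrow> 0) F"
  by (simp add: filterlim_at)

lemma levels2_lim:
  "filterlim fst (at_right 0) levels2" "filterlim snd (at_right 0) levels2"
  unfolding levels2_def by (rule filterlim_fst filterlim_snd)+

lemma levels4_lim:
  "filterlim fst (at_right 0) levels4"
  "filterlim (\<lambda>x. fst (snd x)) (at_right 0) levels4"
  "filterlim (\<lambda>x. fst (snd (snd x))) (at_right 0) levels4"
  "filterlim (\<lambda>x. snd (snd (snd x))) (at_right 0) levels4"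
proof -
  let ?F = "at_right 0 :: real filter"
  have 1: "filterlim snd (?F \<times>\<^sub>F ?F \<times>\<^sub>F ?F) levels4"
    unfolding levels4_def by (rule filterlim_snd)
  have 2: "filterlim (\<lambda>x. snd (snd x)) (?F \<times>\<^sub>F ?F) levels4"
    by (rule filterlim_compose[OF filterlim_snd 1])
  show "filterlim fst ?F levels4"
    unfolding levels4_def by (rule filterlim_fst)
  show "filterlim (\<lambda>x. fst (snd x)) ?F levels4"
    by (rule filterlim_compose[OF filterlim_fst 1])
  show "filterlim (\<lambda>x. fst (snd (snd x))) ?F levels4"
    by (rule filterlim_compose[OF filterlim_fst 2])
  show "filterlim (\<lambda>x. snd (snd (snd x))) ?F levels4"
    by (rule filterlim_compose[OF filterlim_snd 2])
qed

lemma decision_prob_mono: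
  assumes "is_test M T D" "source_law M R" "S \<subseteq> S'"
  shows "measure R {\<omega> \<in> space R. D \<omega> \<in> S} \<le> measure R {\<omega> \<in> space R. D \<omega> \<in> S'}"
proof -
  interpret prob_space R using assms(2) by (rule source_lawD)
  show ?thesis
    using assms by (intro finite_measure_mono decision_measurable[OF assms(1)] source_lawD) auto
qed

lemma decision_prob_Un:
  assumes "is_test M T D" "source_law M R" "S \<subseteq> S1 \<union> S2"
  shows "measure R {\<omega> \<in> space R. D \<omega> \<in> S} \<le>
    measure R {\<omega> \<in> space R. D \<omega> \<in> S1} + measure R {\<omega> \<in> space R. D \<omega> \<in> S2}"
proof -
  have "measure R {\<omega> \<in> space R. D \<omega> \<in> S} \<le> measure R {\<omega> \<in> space R. D \<omega> \<in> S1 \<union> S2}"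
    by (rule decision_prob_mono) fact+
  also have "{\<omega> \<in> space R. D \<omega> \<in> S1 \<union> S2} = {\<omega> \<in> space R. D \<omega> \<in> S1} \<union> {\<omega> \<in> space R. D \<omega> \<in> S2}"
    by auto
  also have "measure R \<dots> \<le> measure R {\<omega> \<in> space R. D \<omega> \<in> S1} + measure R {\<omega> \<in> space R. D \<omega> \<in> S2}"
    by (intro measure_Un_le decision_measurable[OF assms(1)] source_lawD assms(2))
  finally show ?thesis .
qed

lemma E_classD:
  assumes "(T, D) \<in> E_class M \<gamma> \<delta>"
  shows "is_test M T D"
    "Q \<in> PPsi M \<Longrightarrow> measure Q {\<omega> \<in> space Q. D \<omega> \<in> {E. E - act M Q \<noteq> {}}} \<le> \<gamma>"
    "Q \<in> PPsi M \<Longrightarrow> measure Q {\<omega> \<in> space Q. D \<omega> \<in> {E. act M Q - E \<noteq> {}}} \<le> \<delta>"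
  using assms by (auto simp: E_class_def)

lemma C_classD:
  assumes "(T, D) \<in> C_class M \<alpha> \<beta> \<gamma> \<delta>"
  shows "is_test M T D"
    "Q \<in> H0 M \<Longrightarrow> measure Q {\<omega> \<in> space Q. D \<omega> \<in> {E. E \<noteq> {}}} \<le> \<alpha>"
    "Q \<in> PPsi M - H0 M \<Longrightarrow> measure Q {\<omega> \<in> space Q. D \<omega> \<in> {{}}} \<le> \<beta>"
    "Q \<in> PPsi M - H0 M \<Longrightarrow> measure Q {\<omega> \<in> space Q. D \<omega> \<in> {E. E - act M Q \<noteq> {}}} \<le> \<gamma>"
    "Q \<in> PPsi M - H0 M \<Longrightarrow> measure Q {\<omega> \<in> space Q. D \<omega> \<in> {E. act M Q - E \<noteq> {} \<and> E \<noteq> {}}} \<le> \<delta>"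
  using assms by (auto simp: C_class_def)

context isolation_setting
begin

text \<open>
  For a unit \<open>e\<close> with signal, the relevant error is to declare \<open>e\<close> although \<open>Q\<close> has no signal there;
  \<open>Q\<close> may be null everywhere or carry signals on other units, which yields the minimum of two information numbers.
  As \<open>{} \<in> psi M\<close>, the global null laws are subject to the familywise constraints. For a unit without
  signal the relevant error is to miss it under a law with signal on \<open>e\<close>.
\<close>

lemma E_class_lower:
  assumes empty_Psi: "{} \<in> psi M" and \<epsilon>: "0 < \<epsilon>" "\<epsilon> < 1"
  shows "eventually (\<lambda>x. \<forall>T D. (T, D) \<in> E_class M (fst x) (snd x) \<longrightarrow>
     ennreal ((1 - \<epsilon>) * rate_fwer M J P (fst x) (snd x)) \<le> mean_time P T) levels2"
proof -
  let ?J = "\<lambda>Q. J (law M (sources M) P) (law M (sources M) Q)"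
  have "eventually (\<lambda>x. \<forall>e\<in>act M P. \<forall>Q\<in>H0 M \<union> HPsi M e. \<forall>T D S. is_test M T D \<longrightarrow>
      measure Q {\<omega> \<in> space Q. D \<omega> \<in> S} \<le> fst x \<longrightarrow> measure P {\<omega> \<in> space P. D \<omega> \<notin> S} \<le> snd x \<longrightarrow>
      ennreal ((1 - \<epsilon>) * (\<bar>ln (fst x)\<bar> / ?J Q)) \<le> mean_time P T) levels2"
    using finite_families finite_act contrasted_act
    by (intro eventually_ball_finite ballI eventually_lower_bound \<epsilon> levels2_lim level_tendsto_0) auto
  moreover have "eventually (\<lambda>x. \<forall>e\<in>units M - act M P. \<forall>Q\<in>GPsi M e. \<forall>T D S. is_test M T D \<longrightarrow>
      measure Q {\<omega> \<in> space Q. D \<omega> \<in> S} \<le> snd x \<longrightarrow> measure P {\<omega> \<in> space P. D \<omega> \<notin> S} \<le> fst x \<longrightarrow>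
      ennreal ((1 - \<epsilon>) * (\<bar>ln (snd x)\<bar> / ?J Q)) \<le> mean_time P T) levels2"
    using finite_families finite_units contrasted_nonact
    by (intro eventually_ball_finite ballI eventually_lower_bound \<epsilon> levels2_lim level_tendsto_0) auto
  ultimately show ?thesis
  proof (eventually_elim, intro allI impI)
    fix x T D
    assume act: "\<forall>e\<in>act M P. \<forall>Q\<in>H0 M \<union> HPsi M e. \<forall>T D S. is_test M T D \<longrightarrow>
      measure Q {\<omega> \<in> space Q. D \<omega> \<in> S} \<le> fst x \<longrightarrow> measure P {\<omega> \<in> space P. D \<omega> \<notin> S} \<le> snd x \<longrightarrow>
      ennreal ((1 - \<epsilon>) * (\<bar>ln (fst x)\<bar> / ?J Q)) \<le> mean_time P T"
      and nonact: "\<forall>e\<in>units M - act M P. \<forall>Q\<in>GPsi M e. \<forall>T D S. is_test M T D \<longrightarrow>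
      measure Q {\<omega> \<in> space Q. D \<omega> \<in> S} \<le> snd x \<longrightarrow> measure P {\<omega> \<in> space P. D \<omega> \<notin> S} \<le> fst x \<longrightarrow>
      ennreal ((1 - \<epsilon>) * (\<bar>ln (snd x)\<bar> / ?J Q)) \<le> mean_time P T"
      and TD: "(T, D) \<in> E_class M (fst x) (snd x)"
    note test = E_classD(1)[OF TD]
    have PP: "P \<in> PPsi M" using P by simp
    have "rate_fwer M J P (fst x) (snd x) \<in>
      (\<lambda>e. \<bar>ln (fst x)\<bar> / min (info M J P (H0 M) (sources M)) (info M J P (HPsi M e) (sources M)))
       ` act M P \<union>
     (\<lambda>e. \<bar>ln (snd x)\<bar> / info M J P (GPsi M e) (sources M)) ` (units M - act M P)"
      unfolding rate_fwer_def using finite_act finite_units act_nonempty by (intro Max_in) auto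
    then consider e where "e \<in> act M P" "rate_fwer M J P (fst x) (snd x) =
        \<bar>ln (fst x)\<bar> / min (info M J P (H0 M) (sources M)) (info M J P (HPsi M e) (sources M))"
      | e where "e \<in> units M - act M P" "rate_fwer M J P (fst x) (snd x) =
        \<bar>ln (snd x)\<bar> / info M J P (GPsi M e) (sources M)"
      by blast
    then show "ennreal ((1 - \<epsilon>) * rate_fwer M J P (fst x) (snd x)) \<le> mean_time P T"
    proof cases
      case 1
      have eu: "e \<in> units M" using 1 act_subset by auto
      obtain Q where Q: "Q \<in> H0 M \<union> HPsi M e"
        "min (info M J P (H0 M) (sources M)) (info M J P (HPsi M e) (sources M)) = ?J Q"
        using info_attained[OF finite_families(1) nonempty(1), of P "sources M"]
          info_attained[OF finite_families(2) nonempty(3)[OF eu], of P "sources M"]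
        unfolding min_def by (metis UnI1 UnI2)
      have "Q \<in> PPsi M" "e \<notin> act M Q"
        using Q H0_subset_PPsi[OF empty_Psi] act_H0 by (auto simp: HPsi_def)
      then have "measure Q {\<omega> \<in> space Q. D \<omega> \<in> {E. e \<in> E}} \<le> fst x"
        using decision_prob_mono[OF test, of Q "{E. e \<in> E}" "{E. E - act M Q \<noteq> {}}"]
          E_classD(2)[OF TD, of Q] Q source_law_families by fastforce
      moreover have "measure P {\<omega> \<in> space P. D \<omega> \<notin> {E. e \<in> E}} \<le> snd x"
        using decision_prob_mono[OF test source_law_P, of "{E. e \<notin> E}" "{E. act M P - E \<noteq> {}}"]
          E_classD(3)[OF TD PP] 1(1) by fastforce
      ultimately show ?thesis
        using act 1(1) Q(1) test unfolding 1(2) Q(2) by blast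
    next
      case 2
      obtain Q where Q: "Q \<in> GPsi M e" "info M J P (GPsi M e) (sources M) = ?J Q"
        using info_attained[OF finite_families(3) nonempty(2)] 2(1) by blast
      have "Q \<in> PPsi M" "e \<in> act M Q"
        using Q by (auto simp: GPsi_def)
      then have "measure Q {\<omega> \<in> space Q. D \<omega> \<in> {E. e \<notin> E}} \<le> snd x"
        using decision_prob_mono[OF test, of Q "{E. e \<notin> E}" "{E. act M Q - E \<noteq> {}}"]
          E_classD(3)[OF TD, of Q] Q source_law_families by fastforce
      moreover have "measure P {\<omega> \<in> space P. D \<omega> \<notin> {E. e \<notin> E}} \<le> fst x"
        using decision_prob_mono[OF test source_law_P, of "{E. e \<in> E}" "{E. E - act M P \<noteq> {}}"]
          E_classD(2)[OF TD PP] 2(1) by fastforce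
      ultimately show ?thesis
        using nonact 2(1) Q(1) test unfolding 2(2) Q(2) by blast
    qed
  qed
qed

text \<open>
  Under a global null law only false detection is controlled, so the decision is \<open>E \<noteq> {}\<close> and the level
  \<open>\<alpha>\<close>. For units without signal the decision must include \<open>E \<noteq> {}\<close>: missing \<open>e\<close> is controlled
  at level \<open>\<delta>\<close> only jointly with a detection, while missing \<open>e\<close> alone could have probability up to
  \<open>\<beta> + \<delta>\<close> and would spoil the rate. The level \<open>\<beta>\<close> enters solely through the probability, under \<open>P\<close>,
  of not making the decision in question.
\<close>

lemma C_class_lower:
  assumes \<epsilon>: "0 < \<epsilon>" "\<epsilon> < 1"
  shows "eventually (\<lambda>x. \<forall>T D. (T, D) \<in> C_class M (fst x) (fst (snd x)) (fst (snd (snd x))) (snd (snd (snd x))) \<longrightarrow>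
     ennreal ((1 - \<epsilon>) * rate_joint M J P (fst x) (fst (snd (snd x))) (snd (snd (snd x)))) \<le> mean_time P T) levels4"
proof -
  let ?J = "\<lambda>Q. J (law M (sources M) P) (law M (sources M) Q)"
  let ?\<alpha> = "\<lambda>x. fst x :: real" and ?\<beta> = "\<lambda>x. fst (snd x) :: real"
  let ?\<gamma> = "\<lambda>x. fst (snd (snd x)) :: real" and ?\<delta> = "\<lambda>x. snd (snd (snd x)) :: real"
  obtain e0 where e0: "e0 \<in> act M P" using act_nonempty by auto
  have sum0: "((\<lambda>x. ?\<beta> x + ?\<delta> x) \<longlongrightarrow> 0) levels4" "((\<lambda>x. ?\<beta> x + ?\<gamma> x) \<longlongrightarrow> 0) levels4"
    using tendsto_add[OF level_tendsto_0[OF levels4_lim(2)] level_tendsto_0[OF levels4_lim(4)]]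
      tendsto_add[OF level_tendsto_0[OF levels4_lim(2)] level_tendsto_0[OF levels4_lim(3)]]
    by simp_all
  have "eventually (\<lambda>x. \<forall>Q\<in>H0 M. \<forall>T D S. is_test M T D \<longrightarrow>
      measure Q {\<omega> \<in> space Q. D \<omega> \<in> S} \<le> ?\<alpha> x \<longrightarrow> measure P {\<omega> \<in> space P. D \<omega> \<notin> S} \<le> ?\<beta> x \<longrightarrow>
      ennreal ((1 - \<epsilon>) * (\<bar>ln (?\<alpha> x)\<bar> / ?J Q)) \<le> mean_time P T) levels4"
    using finite_families contrasted_act[OF e0]
    by (intro eventually_ball_finite ballI eventually_lower_bound[of e0] \<epsilon> levels4_lim level_tendsto_0) auto
  moreover have "eventually (\<lambda>x. \<forall>e\<in>act M P. \<forall>Q\<in>HPsi M e. \<forall>T D S. is_test M T D \<longrightarrow>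
      measure Q {\<omega> \<in> space Q. D \<omega> \<in> S} \<le> ?\<gamma> x \<longrightarrow> measure P {\<omega> \<in> space P. D \<omega> \<notin> S} \<le> ?\<beta> x + ?\<delta> x \<longrightarrow>
      ennreal ((1 - \<epsilon>) * (\<bar>ln (?\<gamma> x)\<bar> / ?J Q)) \<le> mean_time P T) levels4"
    using finite_families finite_act contrasted_act
    by (intro eventually_ball_finite ballI eventually_lower_bound \<epsilon> levels4_lim sum0) auto
  moreover have "eventually (\<lambda>x. \<forall>e\<in>units M - act M P. \<forall>Q\<in>GPsi M e. \<forall>T D S. is_test M T D \<longrightarrow>
      measure Q {\<omega> \<in> space Q. D \<omega> \<in> S} \<le> ?\<delta> x \<longrightarrow> measure P {\<omega> \<in> space P. D \<omega> \<notin> S} \<le> ?\<beta> x + ?\<gamma> x \<longrightarrow>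
      ennreal ((1 - \<epsilon>) * (\<bar>ln (?\<delta> x)\<bar> / ?J Q)) \<le> mean_time P T) levels4"
    using finite_families finite_units contrasted_nonact
    by (intro eventually_ball_finite ballI eventually_lower_bound \<epsilon> levels4_lim sum0) auto
  ultimately show ?thesis
  proof (eventually_elim, intro allI impI)
    fix x :: "real \<times> real \<times> real \<times> real" and T D
    assume det: "\<forall>Q\<in>H0 M. \<forall>T D S. is_test M T D \<longrightarrow>
      measure Q {\<omega> \<in> space Q. D \<omega> \<in> S} \<le> ?\<alpha> x \<longrightarrow> measure P {\<omega> \<in> space P. D \<omega> \<notin> S} \<le> ?\<beta> x \<longrightarrow>
      ennreal ((1 - \<epsilon>) * (\<bar>ln (?\<alpha> x)\<bar> / ?J Q)) \<le> mean_time P T"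
      and act: "\<forall>e\<in>act M P. \<forall>Q\<in>HPsi M e. \<forall>T D S. is_test M T D \<longrightarrow>
      measure Q {\<omega> \<in> space Q. D \<omega> \<in> S} \<le> ?\<gamma> x \<longrightarrow> measure P {\<omega> \<in> space P. D \<omega> \<notin> S} \<le> ?\<beta> x + ?\<delta> x \<longrightarrow>
      ennreal ((1 - \<epsilon>) * (\<bar>ln (?\<gamma> x)\<bar> / ?J Q)) \<le> mean_time P T"
      and nonact: "\<forall>e\<in>units M - act M P. \<forall>Q\<in>GPsi M e. \<forall>T D S. is_test M T D \<longrightarrow>
      measure Q {\<omega> \<in> space Q. D \<omega> \<in> S} \<le> ?\<delta> x \<longrightarrow> measure P {\<omega> \<in> space P. D \<omega> \<notin> S} \<le> ?\<beta> x + ?\<gamma> x \<longrightarrow>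
      ennreal ((1 - \<epsilon>) * (\<bar>ln (?\<delta> x)\<bar> / ?J Q)) \<le> mean_time P T"
      and TD: "(T, D) \<in> C_class M (?\<alpha> x) (?\<beta> x) (?\<gamma> x) (?\<delta> x)"
    note test = C_classD(1)[OF TD]
    let ?r = "rate_joint M J P (?\<alpha> x) (?\<gamma> x) (?\<delta> x)"
    have "?r \<in> {\<bar>ln (?\<alpha> x)\<bar> / info M J P (H0 M) (sources M)} \<union>
     (\<lambda>e. \<bar>ln (?\<gamma> x)\<bar> / info M J P (HPsi M e) (sources M)) ` act M P \<union>
     (\<lambda>e. \<bar>ln (?\<delta> x)\<bar> / info M J P (GPsi M e) (sources M)) ` (units M - act M P)"
      unfolding rate_joint_def using finite_act finite_units by (intro Max_in) auto
    then consider "?r = \<bar>ln (?\<alpha> x)\<bar> / info M J P (H0 M) (sources M)"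
      | e where "e \<in> act M P" "?r = \<bar>ln (?\<gamma> x)\<bar> / info M J P (HPsi M e) (sources M)"
      | e where "e \<in> units M - act M P" "?r = \<bar>ln (?\<delta> x)\<bar> / info M J P (GPsi M e) (sources M)"
      by blast
    then show "ennreal ((1 - \<epsilon>) * ?r) \<le> mean_time P T"
    proof cases
      case 1
      obtain Q where Q: "Q \<in> H0 M" "info M J P (H0 M) (sources M) = ?J Q"
        using info_attained[OF finite_families(1) nonempty(1)] by blast
      have "measure P {\<omega> \<in> space P. D \<omega> \<notin> {E. E \<noteq> {}}} \<le> ?\<beta> x"
        using C_classD(3)[OF TD P] by simp
      then show ?thesis
        using det Q(1) test C_classD(2)[OF TD Q(1)] unfolding 1 Q(2) by blast
    next
      case 2
      have eu: "e \<in> units M" using 2 act_subset by auto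
      obtain Q where Q: "Q \<in> HPsi M e" "info M J P (HPsi M e) (sources M) = ?J Q"
        using info_attained[OF finite_families(2) nonempty(3)[OF eu]] by blast
      have "Q \<in> PPsi M - H0 M" "e \<notin> act M Q"
        using Q by (auto simp: HPsi_def)
      then have "measure Q {\<omega> \<in> space Q. D \<omega> \<in> {E. e \<in> E}} \<le> ?\<gamma> x"
        using decision_prob_mono[OF test source_law_families(2)[OF Q(1)], of "{E. e \<in> E}" "{E. E - act M Q \<noteq> {}}"]
          C_classD(4)[OF TD, of Q] by fastforce
      moreover have "measure P {\<omega> \<in> space P. D \<omega> \<notin> {E. e \<in> E}} \<le> ?\<beta> x + ?\<delta> x"
        using decision_prob_Un[OF test source_law_P, of "{E. e \<notin> E}" "{{}}" "{E. act M P - E \<noteq> {} \<and> E \<noteq> {}}"]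
          C_classD(3,5)[OF TD P] 2(1) by fastforce
      ultimately show ?thesis
        using act 2(1) Q(1) test unfolding 2(2) Q(2) by blast
    next
      case 3
      obtain Q where Q: "Q \<in> GPsi M e" "info M J P (GPsi M e) (sources M) = ?J Q"
        using info_attained[OF finite_families(3) nonempty(2)] 3(1) by blast
      have "Q \<in> PPsi M - H0 M" "e \<in> act M Q"
        using Q GPsi_not_H0 by (auto simp: GPsi_def)
      then have "measure Q {\<omega> \<in> space Q. D \<omega> \<in> {E. e \<notin> E \<and> E \<noteq> {}}} \<le> ?\<delta> x"
        using decision_prob_mono[OF test source_law_families(3)[OF Q(1)], of "{E. e \<notin> E \<and> E \<noteq> {}}"
            "{E. act M Q - E \<noteq> {} \<and> E \<noteq> {}}"]
          C_classD(5)[OF TD, of Q] by fastforce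
      moreover have "measure P {\<omega> \<in> space P. D \<omega> \<notin> {E. e \<notin> E \<and> E \<noteq> {}}} \<le> ?\<beta> x + ?\<gamma> x"
        using decision_prob_Un[OF test source_law_P, of "{E. \<not> (e \<notin> E \<and> E \<noteq> {})}" "{{}}" "{E. E - act M P \<noteq> {}}"]
          C_classD(3,4)[OF TD P] 3(1) by fastforce
      ultimately show ?thesis
        using nonact 3(1) Q(1) test unfolding 3(2) Q(2) by blast
    qed
  qed
qed

lemma full_info_pos:
  "0 < info M J P (H0 M) (sources M)"
  "e \<in> act M P \<Longrightarrow> 0 < info M J P (HPsi M e) (sources M)"
  "e \<in> units M - act M P \<Longrightarrow> 0 < info M J P (GPsi M e) (sources M)"
proof -
  obtain e0 where e0: "e0 \<in> act M P" using act_nonempty by auto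
  then have "e0 \<in> units M" using act_subset by auto
  from info_pos_act(1)[OF e0 unit_subset[OF this]] show "0 < info M J P (H0 M) (sources M)"
    by simp
  show "0 < info M J P (HPsi M e) (sources M)" if "e \<in> act M P"
    using info_pos_act(2)[OF that unit_subset] that act_subset by auto
  show "0 < info M J P (GPsi M e) (sources M)" if "e \<in> units M - act M P"
    using info_pos_nonact[OF that unit_subset] that by auto
qed

lemma rate_fwer_ge:
  "e \<in> act M P \<Longrightarrow> \<bar>ln \<gamma>\<bar> \<le> info M J P (H0 M) (sources M) * rate_fwer M J P \<gamma> \<delta>"
  "e \<in> act M P \<Longrightarrow> \<bar>ln \<gamma>\<bar> \<le> info M J P (HPsi M e) (sources M) * rate_fwer M J P \<gamma> \<delta>"
  "e \<in> units M - act M P \<Longrightarrow> \<bar>ln \<delta>\<bar> \<le> info M J P (GPsi M e) (sources M) * rate_fwer M J P \<gamma> \<delta>"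
proof -
  let ?S = "(\<lambda>e. \<bar>ln \<gamma>\<bar> / min (info M J P (H0 M) (sources M)) (info M J P (HPsi M e) (sources M))) ` act M P
     \<union> (\<lambda>e. \<bar>ln \<delta>\<bar> / info M J P (GPsi M e) (sources M)) ` (units M - act M P)"
  have le: "y \<le> rate_fwer M J P \<gamma> \<delta>" if "y \<in> ?S" for y
    unfolding rate_fwer_def using that finite_act finite_units by (intro Max_ge) auto
  note pos = full_info_pos
  {
    assume e: "e \<in> act M P"
    let ?m = "min (info M J P (H0 M) (sources M)) (info M J P (HPsi M e) (sources M))"
    have "\<bar>ln \<gamma>\<bar> / ?m \<le> rate_fwer M J P \<gamma> \<delta>"
      using e by (intro le) auto
    moreover have "0 < ?m" using pos(1) pos(2)[OF e] by simp
    moreover from this have "0 \<le> \<bar>ln \<gamma>\<bar> / ?m" by (intro divide_nonneg_pos) auto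
    ultimately have *: "\<bar>ln \<gamma>\<bar> \<le> ?m * rate_fwer M J P \<gamma> \<delta>" "0 \<le> rate_fwer M J P \<gamma> \<delta>"
      by (simp add: pos_divide_le_eq mult.commute, linarith)
    show "\<bar>ln \<gamma>\<bar> \<le> info M J P (H0 M) (sources M) * rate_fwer M J P \<gamma> \<delta>"
      by (rule order_trans[OF *(1) mult_right_mono[OF min.cobounded1 *(2)]])
    show "\<bar>ln \<gamma>\<bar> \<le> info M J P (HPsi M e) (sources M) * rate_fwer M J P \<gamma> \<delta>"
      by (rule order_trans[OF *(1) mult_right_mono[OF min.cobounded2 *(2)]])
  }
  assume e: "e \<in> units M - act M P"
  have "\<bar>ln \<delta>\<bar> / info M J P (GPsi M e) (sources M) \<le> rate_fwer M J P \<gamma> \<delta>"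
    using e by (intro le) auto
  with pos(3)[OF e] show "\<bar>ln \<delta>\<bar> \<le> info M J P (GPsi M e) (sources M) * rate_fwer M J P \<gamma> \<delta>"
    by (simp add: pos_divide_le_eq mult.commute)
qed

lemma rate_joint_ge:
  "\<bar>ln \<alpha>\<bar> \<le> info M J P (H0 M) (sources M) * rate_joint M J P \<alpha> \<gamma> \<delta>"
  "e \<in> act M P \<Longrightarrow> \<bar>ln \<gamma>\<bar> \<le> info M J P (HPsi M e) (sources M) * rate_joint M J P \<alpha> \<gamma> \<delta>"
  "e \<in> units M - act M P \<Longrightarrow> \<bar>ln \<delta>\<bar> \<le> info M J P (GPsi M e) (sources M) * rate_joint M J P \<alpha> \<gamma> \<delta>"
proof -
  let ?S = "{\<bar>ln \<alpha>\<bar> / info M J P (H0 M) (sources M)}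
     \<union> (\<lambda>e. \<bar>ln \<gamma>\<bar> / info M J P (HPsi M e) (sources M)) ` act M P
     \<union> (\<lambda>e. \<bar>ln \<delta>\<bar> / info M J P (GPsi M e) (sources M)) ` (units M - act M P)"
  have le: "y \<le> rate_joint M J P \<alpha> \<gamma> \<delta>" if "y \<in> ?S" for y
    unfolding rate_joint_def using that finite_act finite_units by (intro Max_ge) auto
  have "y \<le> i * rate_joint M J P \<alpha> \<gamma> \<delta>" if "0 < i" "y / i \<in> ?S" for y i
    using le[OF that(2)] that(1) by (simp add: pos_divide_le_eq mult.commute)
  note * = this
  show "\<bar>ln \<alpha>\<bar> \<le> info M J P (H0 M) (sources M) * rate_joint M J P \<alpha> \<gamma> \<delta>"
    by (rule *[OF full_info_pos(1)]) simp
  show "\<bar>ln \<gamma>\<bar> \<le> info M J P (HPsi M e) (sources M) * rate_joint M J P \<alpha> \<gamma> \<delta>" if "e \<in> act M P"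
    by (rule *[OF full_info_pos(2)[OF that]]) (use that in blast)
  show "\<bar>ln \<delta>\<bar> \<le> info M J P (GPsi M e) (sources M) * rate_joint M J P \<alpha> \<gamma> \<delta>" if "e \<in> units M - act M P"
    by (rule *[OF full_info_pos(3)[OF that]]) (use that in blast)
qed

end

text \<open>
  The isolation subsystems are selected so that only the minima over the units agree with those of the full
  system. This is enough, since a bound with the worst unit's information number in the full
  system passes to every unit in its subsystem.
\<close>

lemma Min_image_eq_le:
  fixes f g :: "'a \<Rightarrow> real"
  assumes "finite S" "e \<in> S" "(MIN e\<in>S. f e) = (MIN e\<in>S. g e)" "\<And>e. e \<in> S \<Longrightarrow> b \<le> g e * r" "0 \<le> r"
  shows "b \<le> f e * r"
proof -
  have "(MIN e\<in>S. g e) \<in> g ` S"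
    using assms(1,2) by (intro Min_in) auto
  then obtain e' where "e' \<in> S" "(MIN e\<in>S. g e) = g e'"
    by auto
  moreover have "(MIN e\<in>S. f e) \<le> f e"
    using assms(1,2) by (intro Min_le) auto
  ultimately show ?thesis
    using assms(3-5) by (metis mult_right_mono order_trans)
qed

section \<open>Asymptotic optimality\<close>

text \<open>
  A member of a class attaining the lower bound of the class to first order determines the infimum.
\<close>

lemma time_and_infimum_equiv:
  fixes r :: "'x \<Rightarrow> real" and \<C> :: "'x \<Rightarrow> (('b path \<Rightarrow> enat) \<times> ('b path \<Rightarrow> nat set set)) set"
  assumes r: "filterlim r at_top F"
    and upper: "\<And>\<epsilon>. 0 < \<epsilon> \<Longrightarrow> \<epsilon> < 1 \<Longrightarrow> eventually (\<lambda>x. mean_time P (T x) \<le> ennreal ((1 + \<epsilon>) * r x)) F"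
    and lower: "\<And>\<epsilon>. 0 < \<epsilon> \<Longrightarrow> \<epsilon> < 1 \<Longrightarrow>
      eventually (\<lambda>x. \<forall>T D. (T, D) \<in> \<C> x \<longrightarrow> ennreal ((1 - \<epsilon>) * r x) \<le> mean_time P T) F"
    and member: "eventually (\<lambda>x. (T x, D x) \<in> \<C> x) F"
  shows "ennreal_equiv (\<lambda>x. mean_time P (T x)) F (\<lambda>x. ennreal (r x))"
    and "ennreal_equiv (\<lambda>x. ennreal (r x)) F (\<lambda>x. INF (T, D)\<in>\<C> x. mean_time P T)"
proof -
  have pos: "eventually (\<lambda>x. 0 < r x) F"
    using r unfolding filterlim_at_top_dense by blast
  have "eventually (\<lambda>x. ennreal ((1 - \<epsilon>) * r x) \<le> mean_time P (T x)) F" if "0 < \<epsilon>" "\<epsilon> < 1" for \<epsilon>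
    using lower[OF that] member by eventually_elim blast
  from ennreal_equiv_sandwich(1)[OF this upper pos]
  show "ennreal_equiv (\<lambda>x. mean_time P (T x)) F (\<lambda>x. ennreal (r x))" .
  have "eventually (\<lambda>x. ennreal ((1 - \<epsilon>) * r x) \<le> (INF (T, D)\<in>\<C> x. mean_time P T)) F"
    if "0 < \<epsilon>" "\<epsilon> < 1" for \<epsilon>
    using lower[OF that] by eventually_elim (auto intro!: INF_greatest)
  moreover have "eventually (\<lambda>x. (INF (T, D)\<in>\<C> x. mean_time P T) \<le> ennreal ((1 + \<epsilon>) * r x)) F"
    if "0 < \<epsilon>" "\<epsilon> < 1" for \<epsilon>
    using upper[OF that] member
  proof eventually_elim
    case (elim x)
    have "(INF (T, D)\<in>\<C> x. mean_time P T) \<le> mean_time P (T x)"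
      using elim(2) by (intro INF_lower2[of "(T x, D x)"]) auto
    then show ?case using elim(1) by (rule order_trans)
  qed
  ultimately show "ennreal_equiv (\<lambda>x. ennreal (r x)) F (\<lambda>x. INF (T, D)\<in>\<C> x. mean_time P T)"
    by (rule ennreal_equiv_sandwich(2)[OF _ _ pos])
qed

theorem theorem4p6:
  fixes M :: "'b model"
    and J :: "'b path measure \<Rightarrow> 'b path measure \<Rightarrow> real"
    and d :: "'b design"
    and P :: "'b path measure"
    and A' B' :: "real \<Rightarrow> real \<Rightarrow> nat set \<Rightarrow> real"
    and A B C D :: "real \<Rightarrow> real \<Rightarrow> real \<Rightarrow> real \<Rightarrow> nat set \<Rightarrow> real"
  assumes model: "valid_model M"
    and ac: "mutually_ac M"
    and pos: "info_pos M J"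
    and M: "cond_M M J"
    and CC: "cond_CC M J"
    and design: "valid_design M d"
    and nonempty: "H0 M \<noteq> {}" "\<And>e. e \<in> units M \<Longrightarrow> GPsi M e \<noteq> {}"
      "\<And>e. e \<in> units M \<Longrightarrow> HPsi M e \<noteq> {}"
    and empty_Psi: "{} \<in> psi M"
    and thr_fwer: "\<And>\<gamma> \<delta> e. 0 < \<gamma> \<Longrightarrow> \<gamma> < 1 \<Longrightarrow> 0 < \<delta> \<Longrightarrow> \<delta> < 1 \<Longrightarrow> e \<in> units M \<Longrightarrow>
        0 < A' \<gamma> \<delta> e \<and> 0 < B' \<gamma> \<delta> e"
    and level_fwer: "\<And>\<gamma> \<delta>. 0 < \<gamma> \<Longrightarrow> \<gamma> < 1 \<Longrightarrow> 0 < \<delta> \<Longrightarrow> \<delta> < 1 \<Longrightarrow>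
        (T_fwer M d (A' \<gamma> \<delta>) (B' \<gamma> \<delta>), D_fwer M d (A' \<gamma> \<delta>) (B' \<gamma> \<delta>)) \<in> E_class M \<gamma> \<delta>"
    and asymp_fwer: "\<And>e. e \<in> units M \<Longrightarrow> (\<lambda>(\<gamma>, \<delta>). ln (A' \<gamma> \<delta> e)) \<sim>[levels2] (\<lambda>(\<gamma>, \<delta>). \<bar>ln \<delta>\<bar>)"
      "\<And>e. e \<in> units M \<Longrightarrow> (\<lambda>(\<gamma>, \<delta>). ln (B' \<gamma> \<delta> e)) \<sim>[levels2] (\<lambda>(\<gamma>, \<delta>). \<bar>ln \<gamma>\<bar>)"
    and thr: "\<And>\<alpha> \<beta> \<gamma> \<delta> e. 0 < \<alpha> \<Longrightarrow> \<alpha> < 1 \<Longrightarrow> 0 < \<beta> \<Longrightarrow> \<beta> < 1 \<Longrightarrow>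
        0 < \<gamma> \<Longrightarrow> \<gamma> < 1 \<Longrightarrow> 0 < \<delta> \<Longrightarrow> \<delta> < 1 \<Longrightarrow> e \<in> units M \<Longrightarrow>
        0 < A \<alpha> \<beta> \<gamma> \<delta> e \<and> 0 < B \<alpha> \<beta> \<gamma> \<delta> e \<and> 0 < C \<alpha> \<beta> \<gamma> \<delta> e \<and> 0 < D \<alpha> \<beta> \<gamma> \<delta> e"
    and level: "\<And>\<alpha> \<beta> \<gamma> \<delta>. 0 < \<alpha> \<Longrightarrow> \<alpha> < 1 \<Longrightarrow> 0 < \<beta> \<Longrightarrow> \<beta> < 1 \<Longrightarrow>
        0 < \<gamma> \<Longrightarrow> \<gamma> < 1 \<Longrightarrow> 0 < \<delta> \<Longrightarrow> \<delta> < 1 \<Longrightarrow>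
        (T_star M d (A \<alpha> \<beta> \<gamma> \<delta>) (B \<alpha> \<beta> \<gamma> \<delta>) (C \<alpha> \<beta> \<gamma> \<delta>) (D \<alpha> \<beta> \<gamma> \<delta>),
         D_star M d (A \<alpha> \<beta> \<gamma> \<delta>) (B \<alpha> \<beta> \<gamma> \<delta>) (C \<alpha> \<beta> \<gamma> \<delta>) (D \<alpha> \<beta> \<gamma> \<delta>)) \<in> C_class M \<alpha> \<beta> \<gamma> \<delta>"
    and asymp:
      "\<And>e. e \<in> units M \<Longrightarrow>
        (\<lambda>(\<alpha>, \<beta>, \<gamma>, \<delta>). ln (A \<alpha> \<beta> \<gamma> \<delta> e)) \<sim>[levels4] (\<lambda>(\<alpha>, \<beta>, \<gamma>, \<delta>). \<bar>ln \<delta>\<bar>)"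
      "\<And>e. e \<in> units M \<Longrightarrow>
        (\<lambda>(\<alpha>, \<beta>, \<gamma>, \<delta>). ln (B \<alpha> \<beta> \<gamma> \<delta> e)) \<sim>[levels4] (\<lambda>(\<alpha>, \<beta>, \<gamma>, \<delta>). \<bar>ln \<gamma>\<bar>)"
      "\<And>e. e \<in> units M \<Longrightarrow>
        (\<lambda>(\<alpha>, \<beta>, \<gamma>, \<delta>). ln (C \<alpha> \<beta> \<gamma> \<delta> e)) \<sim>[levels4] (\<lambda>(\<alpha>, \<beta>, \<gamma>, \<delta>). \<bar>ln \<beta>\<bar>)"
      "\<And>e. e \<in> units M \<Longrightarrow>
        (\<lambda>(\<alpha>, \<beta>, \<gamma>, \<delta>). ln (D \<alpha> \<beta> \<gamma> \<delta> e)) \<sim>[levels4] (\<lambda>(\<alpha>, \<beta>, \<gamma>, \<delta>). \<bar>ln \<alpha>\<bar>)"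
    and P: "P \<in> PPsi M - H0 M"
    and det: "(MAX e\<in>act M P. info M J P (H0 M) (det_sub d e)) = info M J P (H0 M) (sources M)"
    and iso: "(MIN e\<in>act M P. info M J P (HPsi M e) (iso_sub d e)) =
              (MIN e\<in>act M P. info M J P (HPsi M e) (sources M))"
      "units M - act M P \<noteq> {} \<Longrightarrow>
         (MIN e\<in>units M - act M P. info M J P (GPsi M e) (iso_sub d e)) =
         (MIN e\<in>units M - act M P. info M J P (GPsi M e) (sources M))"
  shows "ennreal_equiv (\<lambda>(\<gamma>, \<delta>). mean_time P (T_fwer M d (A' \<gamma> \<delta>) (B' \<gamma> \<delta>))) levels2
           (\<lambda>(\<gamma>, \<delta>). ennreal (rate_fwer M J P \<gamma> \<delta>))
    \<and> ennreal_equiv (\<lambda>(\<gamma>, \<delta>). ennreal (rate_fwer M J P \<gamma> \<delta>)) levels2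
           (\<lambda>(\<gamma>, \<delta>). INF (T, D')\<in>E_class M \<gamma> \<delta>. mean_time P T)
    \<and> ennreal_equiv
           (\<lambda>(\<alpha>, \<beta>, \<gamma>, \<delta>).
              mean_time P (T_star M d (A \<alpha> \<beta> \<gamma> \<delta>) (B \<alpha> \<beta> \<gamma> \<delta>) (C \<alpha> \<beta> \<gamma> \<delta>) (D \<alpha> \<beta> \<gamma> \<delta>))) levels4
           (\<lambda>(\<alpha>, \<beta>, \<gamma>, \<delta>). ennreal (rate_joint M J P \<alpha> \<gamma> \<delta>))
    \<and> ennreal_equiv (\<lambda>(\<alpha>, \<beta>, \<gamma>, \<delta>). ennreal (rate_joint M J P \<alpha> \<gamma> \<delta>)) levels4
           (\<lambda>(\<alpha>, \<beta>, \<gamma>, \<delta>). INF (T, D')\<in>C_class M \<alpha> \<beta> \<gamma> \<delta>. mean_time P T)"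
proof -
  interpret isolation_setting M J d P
    by (rule isolation_setting.intro) fact+
  have "Max ((\<lambda>e. info M J P (H0 M) (det_sub d e)) ` act M P) \<in> (\<lambda>e. info M J P (H0 M) (det_sub d e)) ` act M P"
    using finite_act act_nonempty by (intro Max_in) auto
  \<comment> \<open>A unit whose detection subsystem is as informative about the global null as the full system.\<close>
  then obtain e0 where e0: "e0 \<in> act M P" "info M J P (H0 M) (det_sub d e0) = info M J P (H0 M) (sources M)"
    using det by auto
  have rate_top: "filterlim r at_top F"
    if "filterlim \<kappa> (at_right 0) F" "\<And>x. \<bar>ln (\<kappa> x)\<bar> \<le> info M J P (H0 M) (sources M) * r x"
    for \<kappa> r :: "'x \<Rightarrow> real" and F
  proof (rule filterlim_at_top_mono)
    show "filterlim (\<lambda>x. inverse (info M J P (H0 M) (sources M)) * \<bar>ln (\<kappa> x)\<bar>) at_top F"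
      using full_info_pos(1)
      by (intro filterlim_tendsto_pos_mult_at_top[OF tendsto_const] filterlim_compose[OF abs_ln_at_top that(1)]) auto
    show "eventually (\<lambda>x. inverse (info M J P (H0 M) (sources M)) * \<bar>ln (\<kappa> x)\<bar> \<le> r x) F"
      using that(2) full_info_pos(1) by (auto intro!: always_eventually simp: field_simps)
  qed
  have iso_act: "b \<le> info M J P (HPsi M e) (iso_sub d e) * r"
    if "e \<in> act M P" "\<And>e. e \<in> act M P \<Longrightarrow> b \<le> info M J P (HPsi M e) (sources M) * r" "0 \<le> r" for b r e
    using Min_image_eq_le[OF finite_act that(1) iso(1) that(2,3)] .
  have iso_nonact: "b \<le> info M J P (GPsi M e) (iso_sub d e) * r"
    if "e \<in> units M - act M P" "\<And>e. e \<in> units M - act M P \<Longrightarrow> b \<le> info M J P (GPsi M e) (sources M) * r" "0 \<le> r" for b r e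
    using Min_image_eq_le[OF _ that(1) iso(2) that(2,3)] that(1) finite_units by blast

  let ?r2 = "\<lambda>x. rate_fwer M J P (fst x) (snd x)"
  have r2_top: "filterlim ?r2 at_top levels2"
    by (rule rate_top[OF levels2_lim(1) rate_fwer_ge(1)[OF e0(1)]])
  have r2_nonneg: "0 \<le> ?r2 x" for x
    using order_trans[OF abs_ge_zero rate_fwer_ge(1)[OF e0(1)]] full_info_pos(1)
    by (simp add: zero_le_mult_iff)
  have lev2: "eventually (\<lambda>x. 0 < fst x \<and> fst x < 1 \<and> 0 < snd x \<and> snd x < 1) levels2"
    using eventually_level[OF levels2_lim(1)] eventually_level[OF levels2_lim(2)]
    by eventually_elim simp
  have upper2: "eventually (\<lambda>x. mean_time P (T_fwer M d (A' (fst x) (snd x)) (B' (fst x) (snd x)))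
      \<le> ennreal ((1 + \<epsilon>) * ?r2 x)) levels2" if "0 < \<epsilon>" "\<epsilon> < 1" for \<epsilon>
  proof (rule eventually_T_star_le[OF e0(1) _ _ _ _ _ r2_top])
    show "eventually (\<lambda>x. 0 < A' (fst x) (snd x) e \<and> 0 < B' (fst x) (snd x) e \<and> 0 < B' (fst x) (snd x) e) levels2"
      if "e \<in> units M" for e
      using lev2 by eventually_elim (use thr_fwer that in auto)
    show "eventually (\<lambda>x. 0 < \<bar>ln (fst x)\<bar> \<and> 0 < \<bar>ln (fst x)\<bar> \<and> 0 < \<bar>ln (snd x)\<bar>) levels2"
      using lev2 by eventually_elim auto
    show "eventually (\<lambda>x. \<bar>ln (fst x)\<bar> \<le> info M J P (H0 M) (det_sub d e0) * ?r2 x) levels2"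
      unfolding e0(2) by (intro always_eventually allI rate_fwer_ge(1)[OF e0(1)])
    show "eventually (\<lambda>x. \<bar>ln (fst x)\<bar> \<le> info M J P (HPsi M e) (iso_sub d e) * ?r2 x) levels2"
      if "e \<in> act M P" for e
      by (intro always_eventually allI iso_act[OF that] rate_fwer_ge(2) r2_nonneg)
    show "eventually (\<lambda>x. \<bar>ln (snd x)\<bar> \<le> info M J P (GPsi M e) (iso_sub d e) * ?r2 x) levels2"
      if "e \<in> units M - act M P" for e
      by (intro always_eventually allI iso_nonact[OF that] rate_fwer_ge(3) r2_nonneg)
  qed (use asymp_fwer that in \<open>simp_all add: case_prod_unfold\<close>)
  have member2: "eventually (\<lambda>x. (T_fwer M d (A' (fst x) (snd x)) (B' (fst x) (snd x)),
      D_fwer M d (A' (fst x) (snd x)) (B' (fst x) (snd x))) \<in> E_class M (fst x) (snd x)) levels2"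
    using lev2 by eventually_elim (use level_fwer in auto)
  note fwer = time_and_infimum_equiv[OF r2_top upper2 E_class_lower[OF empty_Psi] member2]

  let ?\<alpha> = "\<lambda>x. fst x :: real" and ?\<beta> = "\<lambda>x. fst (snd x) :: real"
  let ?\<gamma> = "\<lambda>x. fst (snd (snd x)) :: real" and ?\<delta> = "\<lambda>x. snd (snd (snd x)) :: real"
  let ?r4 = "\<lambda>x. rate_joint M J P (?\<alpha> x) (?\<gamma> x) (?\<delta> x)"
  have r4_top: "filterlim ?r4 at_top levels4"
    by (rule rate_top[OF levels4_lim(1) rate_joint_ge(1)])
  have r4_nonneg: "0 \<le> ?r4 x" for x
    using order_trans[OF abs_ge_zero rate_joint_ge(1)] full_info_pos(1)
    by (simp add: zero_le_mult_iff)
  have lev4: "eventually (\<lambda>x. (0 < ?\<alpha> x \<and> ?\<alpha> x < 1) \<and> (0 < ?\<beta> x \<and> ?\<beta> x < 1) \<and>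
      (0 < ?\<gamma> x \<and> ?\<gamma> x < 1) \<and> (0 < ?\<delta> x \<and> ?\<delta> x < 1)) levels4"
    by (intro eventually_conj eventually_level levels4_lim)
  have upper4: "eventually (\<lambda>x. mean_time P (T_star M d (A (?\<alpha> x) (?\<beta> x) (?\<gamma> x) (?\<delta> x))
      (B (?\<alpha> x) (?\<beta> x) (?\<gamma> x) (?\<delta> x)) (C (?\<alpha> x) (?\<beta> x) (?\<gamma> x) (?\<delta> x)) (D (?\<alpha> x) (?\<beta> x) (?\<gamma> x) (?\<delta> x)))
      \<le> ennreal ((1 + \<epsilon>) * ?r4 x)) levels4" if "0 < \<epsilon>" "\<epsilon> < 1" for \<epsilon>
  proof (rule eventually_T_star_le[OF e0(1) _ _ _ _ _ r4_top])
    show "eventually (\<lambda>x. 0 < A (?\<alpha> x) (?\<beta> x) (?\<gamma> x) (?\<delta> x) e \<and> 0 < B (?\<alpha> x) (?\<beta> x) (?\<gamma> x) (?\<delta> x) e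
        \<and> 0 < D (?\<alpha> x) (?\<beta> x) (?\<gamma> x) (?\<delta> x) e) levels4"
      if "e \<in> units M" for e
      using lev4 by eventually_elim (use thr that in auto)
    show "eventually (\<lambda>x. 0 < \<bar>ln (?\<alpha> x)\<bar> \<and> 0 < \<bar>ln (?\<gamma> x)\<bar> \<and> 0 < \<bar>ln (?\<delta> x)\<bar>) levels4"
      using lev4 by eventually_elim auto
    show "eventually (\<lambda>x. \<bar>ln (?\<alpha> x)\<bar> \<le> info M J P (H0 M) (det_sub d e0) * ?r4 x) levels4"
      unfolding e0(2) by (intro always_eventually allI rate_joint_ge(1))
    show "eventually (\<lambda>x. \<bar>ln (?\<gamma> x)\<bar> \<le> info M J P (HPsi M e) (iso_sub d e) * ?r4 x) levels4"
      if "e \<in> act M P" for e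
      by (intro always_eventually allI iso_act[OF that] rate_joint_ge(2) r4_nonneg)
    show "eventually (\<lambda>x. \<bar>ln (?\<delta> x)\<bar> \<le> info M J P (GPsi M e) (iso_sub d e) * ?r4 x) levels4"
      if "e \<in> units M - act M P" for e
      by (intro always_eventually allI iso_nonact[OF that] rate_joint_ge(3) r4_nonneg)
  qed (use asymp that in \<open>simp_all add: case_prod_unfold\<close>)
  have member4: "eventually (\<lambda>x. (T_star M d (A (?\<alpha> x) (?\<beta> x) (?\<gamma> x) (?\<delta> x))
      (B (?\<alpha> x) (?\<beta> x) (?\<gamma> x) (?\<delta> x)) (C (?\<alpha> x) (?\<beta> x) (?\<gamma> x) (?\<delta> x)) (D (?\<alpha> x) (?\<beta> x) (?\<gamma> x) (?\<delta> x)),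
      D_star M d (A (?\<alpha> x) (?\<beta> x) (?\<gamma> x) (?\<delta> x))
      (B (?\<alpha> x) (?\<beta> x) (?\<gamma> x) (?\<delta> x)) (C (?\<alpha> x) (?\<beta> x) (?\<gamma> x) (?\<delta> x)) (D (?\<alpha> x) (?\<beta> x) (?\<gamma> x) (?\<delta> x)))
      \<in> C_class M (?\<alpha> x) (?\<beta> x) (?\<gamma> x) (?\<delta> x)) levels4"
    using lev4 by eventually_elim (use level in auto)
  note joint = time_and_infimum_equiv[OF r4_top upper4 C_class_lower member4]
  show ?thesis
    using fwer joint by (simp add: case_prod_unfold)
qed

end
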